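(* Let $I_1$ be the first nontrivial elliptic local integral of motion acting on the tensor product $\mathcal F(u_1)\otimes\mathcal F(u_2)$ of Fock modules of $\mathcal E_1$, as defined in the context. In the Intermediate Long Wave limit, $h\to0$ with $r,\tau,\beta=(r-1)/r,\hat\pi$ fixed, one has $$I_1=2+\beta h^2\,\mathbf I_1+\beta^{3/2}h^3\,\mathbf I_2+O(h^4),$$ with $$\mathbf I_1=L_0+\frac{(1-\beta)^2}{4\beta}+2\sum_{m>0}a_{-m}a_m,$$ $$\mathbf I_2=\sum_{m\ne0}L_{-m}a_m-\frac{2(1-\beta)}{\sqrt\beta}\sum_{m>0}m\coth(m\tau)\,a_{-m}a_m+\frac13\sum_{k+l+m=0}a_ka_la_m .$$
   Context: Parameters: $q_1=x^{2(1-r)}$, $q_2=q^2=x^{-2}$, $q_3=x^{2r}$, $p=x^{2s}$, with $x^{2r}=e^h$, $x^{2s}=e^{2\tau}$; $q=x^{-1}$; $u_1,u_2$ are normalized by $q^{-1}u_1=x^{\hat\pi}$, $q^{-1}u_2=x^{-\hat\pi}$ (so $u_2/u_1=x^{-2\hat\pi}$). $[m]=(q^m-q^{-m})/(q-q^{-1})$. Each Fock module $\mathcal F(u)$ is $\mathbb C[H^\perp_{-m}\mid m>0]$ with $[H^\perp_m,H^\perp_n]=-\delta_{m+n,0}\frac{[m]}{m(q-q^{-1})}(1-q_1^m)(1-q_2^m)(1-q_3^m)$. On $\mathcal F(u_1)\otimes\mathcal F(u_2)$ set, for $m>0$, $\Delta H^\perp_{-m}=H^\perp_{-m}\otimes1+q^m\,1\otimes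 H^\perp_{-m}$, $\Delta H^\perp_m=q^{-m}H^\perp_m\otimes1+1\otimes H^\perp_m$ (diagonal Heisenberg algebra) and $\bar H^\perp_{-m}=q^mH^\perp_{-m}\otimes1-1\otimes H^\perp_{-m}$, $\bar H^\perp_m=H^\perp_m\otimes1-q^{-m}1\otimes H^\perp_m$ (these commute with all $\Delta H^\perp_n$). The dressed current of $\mathcal E_1$ acts as $\Delta\hat F^\perp(z)=\mathsf T^{DV}(z)\,\Delta Z(z)$, where $$\mathsf T^{DV}(z)=x^{\hat\pi}:\exp\Bigl(\sum_{m\ne0}\frac{(qz)^{-m}}{[2m]}\bar H^\perp_m\Bigr):+x^{-\hat\pi}:\exp\Bigl(-\sum_{m\ne0}\frac{(q^{-1}z)^{-m}}{[2m]}\bar H^\perp_m\Bigr):,$$ $$\Delta Z(z)=\exp\Bigl(-\sum_{m>0}\frac{\Delta H^\perp_{-m}}{[2m]}z^m\Bigr)\exp\Bigl(\sum_{m>0}\frac{q^{-2m}-p^mq^{2m}}{1-p^m}\frac{\Delta H^\perp_m}{[2m]}z^{-m}\Bigr).$$ $I_1$ is the constant term $I_1=\oint\Delta\hat F^\perp(z)\frac{dz}{2\pi\sqrt{-1}z}$. Oscillators in the limit. As $h\to0$ (oscillators being rescaled to $h$-independent ones), $\mathsf T^{DV}(z)=2+\beta h^2\bigl(\sum_{n}L_nz^{-n}+\frac{(1-\beta)^2}{4\beta}\bigr)+O(h^4)$, which defines operators $L_n$ generating the Virasoro algebra with central charge $c=1-6\frac{(1-\beta)^2}\beta$ and highest weight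 $\Delta=\frac{(1-\beta)^2}{4\beta}(\hat\pi^2-1)$. Write $\Delta Z(z)=:\exp(\sum_{m\ne0}\alpha_mz^{-m}):$; then $[\alpha_m,\alpha_n]=\delta_{m+n,0}\,\beta\frac m2h^2\bigl(1-m\coth(m\tau)\frac hr+O(h^2)\bigr)$ and one sets, for $m>0$, $\alpha_{-m}=\sqrt\beta h(1+O(h^2))a_{-m}$, $\alpha_m=\sqrt\beta h\bigl(1-m\coth(m\tau)\frac hr+O(h^2)\bigr)a_m$, so that $[a_m,a_n]=\frac m2\delta_{m+n,0}$ and $[a_m,L_n]=0$. The cubic sum is over nonzero integers $k,l,m$. *)

theory Defs
  imports Complex_Main "HOL-Library.Multiset" "HOL-Library.Poly_Mapping" "HOL-Library.Landau_Symbols"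
begin

section \<open>Fock spaces as polynomial rings\<close>

text \<open>A monomial is a multiset of variables, so \<^typ>\<open>('i \<times> nat) multiset \<Rightarrow>\<^sub>0 complex\<close>
  is the polynomial ring over the complex numbers in the variables indexed by
  \<^typ>\<open>'i \<times> nat\<close>. The pair \<open>(i, k)\<close> stands for the creation operator of mode
  \<open>-(k + 1)\<close> of species \<open>i\<close>: the shift makes the variables correspond exactly to \<open>m > 0\<close>.
  The vacuum is \<open>1\<close>.\<close>

type_synonym 'i fock = "('i \<times> nat) multiset \<Rightarrow>\<^sub>0 complex"

definition scal :: "complex \<Rightarrow> 'i fock \<Rightarrow> 'i fock" where
  "scal c v = Poly_Mapping.single 0 c * v"

definition var :: "'i \<times> nat \<Rightarrow> 'i fock" where
  "var x = Poly_Mapping.single {#x#} 1"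

definition pdiff :: "'i \<times> nat \<Rightarrow> 'i fock \<Rightarrow> 'i fock" where
  "pdiff x v = (\<Sum>M\<in>Poly_Mapping.keys v.
     Poly_Mapping.single (M - {#x#}) (of_nat (count M x) * Poly_Mapping.lookup v M))"

definition subst :: "('i \<times> nat \<Rightarrow> 'j fock) \<Rightarrow> 'i fock \<Rightarrow> 'j fock" where
  "subst \<phi> v = (\<Sum>M\<in>Poly_Mapping.keys v.
     scal (Poly_Mapping.lookup v M) (\<Prod>x\<in>#M. \<phi> x))"

text \<open>The Fock representation of the Heisenberg algebra with
  \<open>[b\<^sub>m, b\<^sub>-\<^sub>m] = C m\<close> for \<open>m > 0\<close>, on the variables of species \<open>i\<close>. There is no zero mode;
  the value at \<open>n = 0\<close> is a dummy.\<close>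

definition heis :: "(nat \<Rightarrow> complex) \<Rightarrow> 'i \<Rightarrow> int \<Rightarrow> 'i fock \<Rightarrow> 'i fock" where
  "heis C i n v =
     (if n < 0 then var (i, nat (- n) - 1) * v
      else if n > 0 then scal (C (nat n)) (pdiff (i, nat n - 1) v)
      else 0)"


section \<open>Modes of exponentials\<close>

text \<open>For commuting operators \<open>c 1, c 2, \<dots>\<close>, the coefficient of \<open>w\<^sup>n\<close> in
  \<open>exp (\<Sum>m>0. c m w\<^sup>m)\<close>. The sum runs over the (finitely many) compositions of \<open>n\<close>, i.e.
  over all the terms of total degree \<open>n\<close> in the powers of the exponent.\<close>

definition exp_mode :: "(nat \<Rightarrow> 'i fock \<Rightarrow> 'i fock) \<Rightarrow> nat \<Rightarrow> 'i fock \<Rightarrow> 'i fock" where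
  "exp_mode c n v = (\<Sum>ms\<in>{ms. 0 \<notin> set ms \<and> sum_list ms = n}.
     scal (1 / fact (length ms)) (foldr c ms v))"

text \<open>The coefficient of \<open>z\<^sup>-\<^sup>n\<close> in the normally ordered exponential
  \<open>:exp (\<Sum>m\<noteq>0. c m z\<^sup>-\<^sup>m): = exp (\<Sum>m>0. c (-m) z\<^sup>m) exp (\<Sum>m>0. c m z\<^sup>-\<^sup>m)\<close>.
  Here and below \<^const>\<open>Sum_any\<close> is the sum of a family with finitely many nonzero members;
  on any given vector all the mode sums considered have this property.\<close>

definition nexp_mode :: "(int \<Rightarrow> 'i fock \<Rightarrow> 'i fock) \<Rightarrow> int \<Rightarrow> 'i fock \<Rightarrow> 'i fock" where
  "nexp_mode c n v = Sum_any (\<lambda>(j, k).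
     if int k - int j = n
     then exp_mode (\<lambda>m. c (- int m)) j (exp_mode (\<lambda>m. c (int m)) k v)
     else 0)"


section \<open>Parameters\<close>

text \<open>The independent parameters are \<open>r, \<tau>, h\<close> and the scalar \<open>\<pi>\<close> (often written with a
  hat). As \<open>x\<^sup>2\<^sup>r = e\<^sup>h\<close>, the power \<open>x\<^sup>a\<close> is \<open>exp (a h / (2 r))\<close>.\<close>

definition xpow :: "complex \<Rightarrow> complex \<Rightarrow> complex \<Rightarrow> complex" where
  "xpow r h a = exp (a * h / (2 * r))"

definition qq :: "complex \<Rightarrow> complex \<Rightarrow> complex" where
  "qq r h = xpow r h (- 1)"

definition q1 :: "complex \<Rightarrow> complex \<Rightarrow> complex" where
  "q1 r h = xpow r h (2 * (1 - r))"

definition q2 :: "complex \<Rightarrow> complex \<Rightarrow> complex" where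
  "q2 r h = xpow r h (- 2)"

definition q3 :: "complex \<Rightarrow> complex \<Rightarrow> complex" where
  "q3 r h = xpow r h (2 * r)"

definition pp :: "complex \<Rightarrow> complex" where
  "pp \<tau> = exp (2 * \<tau>)"

definition beta :: "complex \<Rightarrow> complex" where
  "beta r = (r - 1) / r"

definition qint :: "complex \<Rightarrow> complex \<Rightarrow> int \<Rightarrow> complex" where
  "qint r h m = (qq r h powi m - qq r h powi (- m)) / (qq r h - inverse (qq r h))"

definition coth :: "complex \<Rightarrow> complex" where
  "coth z = cosh z / sinh z"

text \<open>The limit \<open>h \<rightarrow> 0\<close> is taken along those \<open>h\<close> for which \<open>q\<close> is not a root of unity; for the
  other values some \<open>[2m]\<close> vanishes and the currents are undefined.\<close>

definition ILW :: "complex \<Rightarrow> complex filter" where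
  "ILW r = at 0 within {h. \<forall>m>0. qq r h ^ m \<noteq> 1}"

definition eq_mod_h4 :: "complex \<Rightarrow> (complex \<Rightarrow> 'i fock) \<Rightarrow> (complex \<Rightarrow> 'i fock) \<Rightarrow> bool" where
  "eq_mod_h4 r u v \<longleftrightarrow>
     (\<forall>M. (\<lambda>h. Poly_Mapping.lookup (u h - v h) M) \<in> O[ILW r](\<lambda>h. h ^ 4))"


section \<open>The tensor product of two Fock modules\<close>

datatype leg = First | Second

text \<open>The tensor product of the Fock modules with parameters \<open>u\<^sub>1, u\<^sub>2\<close> is
  \<^typ>\<open>leg fock\<close>, the polynomial ring in the generators of both factors. The parameters
  \<open>u\<^sub>1 = q x\<^sup>\<pi>\<close> and \<open>u\<^sub>2 = q x\<^sup>-\<^sup>\<pi>\<close> enter only via \<open>x\<^sup>\<pi>\<close> in the current \<open>TDV\<close>.\<close>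

definition hcomm :: "complex \<Rightarrow> complex \<Rightarrow> nat \<Rightarrow> complex" where
  "hcomm r h m = - (qint r h (int m) / (of_nat m * (qq r h - inverse (qq r h))))
     * (1 - q1 r h ^ m) * (1 - q2 r h ^ m) * (1 - q3 r h ^ m)"

definition H :: "complex \<Rightarrow> complex \<Rightarrow> leg \<Rightarrow> int \<Rightarrow> leg fock \<Rightarrow> leg fock" where
  "H r h i n = heis (hcomm r h) i n"

definition DeltaH :: "complex \<Rightarrow> complex \<Rightarrow> int \<Rightarrow> leg fock \<Rightarrow> leg fock" where
  "DeltaH r h n v =
     (if n < 0 then H r h First n v + scal (qq r h powi (- n)) (H r h Second n v)
      else scal (qq r h powi (- n)) (H r h First n v) + H r h Second n v)"

definition barH :: "complex \<Rightarrow> complex \<Rightarrow> int \<Rightarrow> leg fock \<Rightarrow> leg fock" where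
  "barH r h n v =
     (if n < 0 then scal (qq r h powi (- n)) (H r h First n v) - H r h Second n v
      else H r h First n v - scal (qq r h powi (- n)) (H r h Second n v))"

text \<open>The modes of \<open>T\<^sup>D\<^sup>V(z) = \<Sum>n. TDV n z\<^sup>-\<^sup>n\<close>.\<close>

definition TDV :: "complex \<Rightarrow> complex \<Rightarrow> complex \<Rightarrow> int \<Rightarrow> leg fock \<Rightarrow> leg fock" where
  "TDV r \<pi> h n v =
     scal (xpow r h \<pi>)
       (nexp_mode (\<lambda>m u. scal (qq r h powi (- m) / qint r h (2 * m)) (barH r h m u)) n v)
   + scal (xpow r h (- \<pi>))
       (nexp_mode (\<lambda>m u. scal (- (qq r h powi m / qint r h (2 * m))) (barH r h m u)) n v)"

text \<open>The exponents \<open>\<alpha>\<^sub>n\<close> of \<open>\<Delta>Z(z) = :exp (\<Sum>n\<noteq>0. \<alpha>\<^sub>n z\<^sup>-\<^sup>n):\<close>.\<close>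

definition alpha :: "complex \<Rightarrow> complex \<Rightarrow> complex \<Rightarrow> int \<Rightarrow> leg fock \<Rightarrow> leg fock" where
  "alpha r \<tau> h n v =
     (if n < 0 then scal (- (1 / qint r h (2 * (- n)))) (DeltaH r h n v)
      else scal ((qq r h powi (- 2 * n) - pp \<tau> ^ nat n * qq r h powi (2 * n))
                   / (1 - pp \<tau> ^ nat n) / qint r h (2 * n)) (DeltaH r h n v))"

definition DeltaZ :: "complex \<Rightarrow> complex \<Rightarrow> complex \<Rightarrow> int \<Rightarrow> leg fock \<Rightarrow> leg fock" where
  "DeltaZ r \<tau> h n v = nexp_mode (alpha r \<tau> h) n v"

text \<open>The constant term of \<open>T\<^sup>D\<^sup>V(z) \<Delta>Z(z)\<close>.\<close>

definition local_IM1 :: "complex \<Rightarrow> complex \<Rightarrow> complex \<Rightarrow> complex \<Rightarrow> leg fock \<Rightarrow> leg fock" where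
  "local_IM1 r \<tau> \<pi> h v = Sum_any (\<lambda>n::int. TDV r \<pi> h n (DeltaZ r \<tau> h (- n) v))"


section \<open>Rescaled oscillators\<close>

datatype osc = Diag | Bar

text \<open>The Fock space of the oscillators that do not depend on \<open>h\<close>: species \<^term>\<open>Diag\<close> are
  the \<open>a\<^sub>n\<close>, species \<^term>\<open>Bar\<close> the rescaled version of \<open>barH\<close>.\<close>

definition a :: "int \<Rightarrow> osc fock \<Rightarrow> osc fock" where
  "a n = heis (\<lambda>m. of_nat m / 2) Diag n"

text \<open>The isomorphism from the Fock space of the rescaled oscillators to the one of the original
  oscillators at \<open>h\<close>. It is determined by
  \<open>\<alpha>\<^sub>-\<^sub>m = \<surd>\<beta> h f\<^sub>m(h) a\<^sub>-\<^sub>m\<close> and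
  \<open>barH\<^sub>-\<^sub>m / [-2m] = \<surd>\<beta> h g\<^sub>m(h) b\<^sub>-\<^sub>m\<close> for \<open>m > 0\<close>, where \<open>b\<^sub>-\<^sub>m\<close> are the creation
  operators of species \<^term>\<open>Bar\<close> and \<open>f\<^sub>m, g\<^sub>m = 1 + O(h\<^sup>2)\<close>.
  The scaling of the annihilation operators is then forced by the commutation relations; in
  particular \<open>\<alpha>\<^sub>m = \<surd>\<beta> h (1 - m coth(m \<tau>) h / r + O(h\<^sup>2)) a\<^sub>m\<close> follows from
  \<open>[a\<^sub>m, a\<^sub>-\<^sub>m] = m/2\<close>.\<close>

definition rescale :: "complex \<Rightarrow> complex \<Rightarrow> (nat \<Rightarrow> complex \<Rightarrow> complex)
    \<Rightarrow> (nat \<Rightarrow> complex \<Rightarrow> complex) \<Rightarrow> complex \<Rightarrow> osc fock \<Rightarrow> leg fock" where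
  "rescale r \<tau> f g h = subst (\<lambda>(s, k). let m = Suc k in
     case s of
       Diag \<Rightarrow> scal (1 / (csqrt (beta r) * h * f m h)) (alpha r \<tau> h (- int m) 1)
     | Bar \<Rightarrow> scal (1 / (csqrt (beta r) * h * g m h) / qint r h (- 2 * int m))
                 (barH r h (- int m) 1))"

definition admissible_scaling :: "complex \<Rightarrow> (nat \<Rightarrow> complex \<Rightarrow> complex) \<Rightarrow> bool" where
  "admissible_scaling r f \<longleftrightarrow>
     (\<forall>m>0. (\<lambda>h. f m h - 1) \<in> O[ILW r](\<lambda>h. h ^ 2)) \<and>
     (\<forall>\<^sub>F h in ILW r. \<forall>m>0. f m h \<noteq> 0)"

definition transport :: "('i fock \<Rightarrow> 'j fock) \<Rightarrow> ('j fock \<Rightarrow> 'j fock) \<Rightarrow> 'i fock \<Rightarrow> 'i fock" where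
  "transport \<Phi> A v = inv \<Phi> (A (\<Phi> v))"

text \<open>The operator \<open>L\<^sub>n\<close> defined by
  \<open>T\<^sup>D\<^sup>V(z) = 2 + \<beta> h\<^sup>2 (\<Sum>n. L\<^sub>n z\<^sup>-\<^sup>n + (1 - \<beta>)\<^sup>2 / (4 \<beta>)) + O(h\<^sup>4)\<close>, read mode by mode; \<open>\<Phi>\<close> is a
  family of isomorphisms such as \<^term>\<open>rescale r \<tau> f g\<close>.\<close>

definition Lop :: "complex \<Rightarrow> complex \<Rightarrow> (complex \<Rightarrow> osc fock \<Rightarrow> leg fock)
    \<Rightarrow> int \<Rightarrow> osc fock \<Rightarrow> osc fock" where
  "Lop r \<pi> \<Phi> n v = (THE w. eq_mod_h4 r
     (\<lambda>h. transport (\<Phi> h) (TDV r \<pi> h n) v)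
     (\<lambda>h. (if n = 0 then scal 2 v else 0)
        + scal (beta r * h ^ 2)
            (w + (if n = 0 then scal ((1 - beta r)^2 / (4 * beta r)) v else 0))))"

definition ILW_I1 :: "complex \<Rightarrow> (int \<Rightarrow> osc fock \<Rightarrow> osc fock) \<Rightarrow> osc fock \<Rightarrow> osc fock" where
  "ILW_I1 r L v = L 0 v + scal ((1 - beta r)^2 / (4 * beta r)) v
     + scal 2 (Sum_any (\<lambda>m::nat. if m > 0 then a (- int m) (a (int m) v) else 0))"

definition ILW_I2 :: "complex \<Rightarrow> complex \<Rightarrow> (int \<Rightarrow> osc fock \<Rightarrow> osc fock)
    \<Rightarrow> osc fock \<Rightarrow> osc fock" where
  "ILW_I2 r \<tau> L v =
     Sum_any (\<lambda>m::int. if m \<noteq> 0 then L (- m) (a m v) else 0)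
   - scal (2 * (1 - beta r) / csqrt (beta r))
       (Sum_any (\<lambda>m::nat. if m > 0
          then scal (of_nat m * coth (of_nat m * \<tau>)) (a (- int m) (a (int m) v)) else 0))
   + scal (1 / 3)
       (Sum_any (\<lambda>(k::int, l::int, m::int).
          if k \<noteq> 0 \<and> l \<noteq> 0 \<and> m \<noteq> 0 \<and> k + l + m = 0 then a k (a l (a m v)) else 0))"

end

theory Submission
  imports Defs "HOL-Analysis.Complex_Transcendental"
begin

text \<open>
  On a vector of degree at most \<open>D\<close> every product of annihilation operators of total mode above \<open>D\<close> is
  zero. Each mode of a normally ordered exponential is therefore a finite sum of normally ordered words
  in the oscillators, and the parameters of the exponent only enter the coefficients of the words
  (\<open>nexp_mode_eq\<close>). In the rescaled oscillators (\<open>transport_local_IM1\<close>) the words do not depend on \<open>h\<close>, so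
  the theorem becomes an asymptotic statement about scalars, the coefficients of a product of a word in
  the barred and a word in the diagonal oscillators.

  Let \<open>s = \<surd>\<beta> h\<close>. A word of length \<open>N\<close> has a coefficient of order \<open>s\<^sup>N\<close>. In \<open>T\<^sup>D\<^sup>V\<close> the two exponentials have,
  up to powers of \<open>q\<close>, opposite exponents, and these powers only depend on the total mode \<open>n\<close> of the
  word. Its coefficient is thus \<open>(e\<^sup>w + (-1)\<^sup>N e\<^sup>-\<^sup>w) s\<^sup>N (\<gamma> + O(h\<^sup>2))\<close>, where \<open>w = (\<pi> + n) h / (2 r)\<close> and \<open>\<gamma>\<close> is the
  reciprocal of two factorials. The parity of the hyperbolic functions leaves only \<open>2\<close>, for the empty
  word, and a term of order \<open>h\<^sup>2\<close>, up to \<open>O(h\<^sup>4)\<close> (\<open>TDV_weight_expansion\<close>). This term is by definition \<open>L\<^sub>n\<close> with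
  its constant, so \<open>L\<^sub>n\<close> is known through its coefficients on words (\<open>Lop_eq\<close>).

  In \<open>\<Delta>Z\<close> the elliptic factor makes the annihilation modes equal to
  \<open>s (1 - m coth (m \<tau>) h / r + O(h\<^sup>2)) a\<^sub>m\<close>, with an odd correction (\<open>dressing_expansion\<close>). Multiplying both
  expansions, two contributions remain (\<open>product_expansion\<close>). The term of order \<open>h\<^sup>2\<close> of \<open>T\<^sup>D\<^sup>V\<close> meets the
  words of length at most \<open>1\<close> in \<open>\<Delta>Z\<close>, which gives \<open>L\<^sub>0\<close> with its constant at order \<open>h\<^sup>2\<close> and
  \<open>\<Sum>m\<noteq>0. L\<^sub>-\<^sub>m a\<^sub>m\<close> at order \<open>h\<^sup>3\<close>. The leading term \<open>2\<close> meets the constant term of \<open>\<Delta>Z\<close> up to length \<open>3\<close>: the words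
  \<open>a\<^sub>-\<^sub>m a\<^sub>m\<close> give the quadratic sum at order \<open>h\<^sup>2\<close> and, from the odd correction, the sum with the hyperbolic
  cotangent at order \<open>h\<^sup>3\<close>, while the words of length \<open>3\<close> give the cubic sum. In the latter, nonzero modes with
  sum zero commute, so that normal ordering is immaterial (\<open>cubic_sum\<close>).
\<close>

section \<open>Calculus on the Fock space\<close>

abbreviation lookup :: "'i fock \<Rightarrow> ('i \<times> nat) multiset \<Rightarrow> complex" where
  "lookup \<equiv> Poly_Mapping.lookup"

lemma lookup_scal [simp]: "lookup (scal c v) M = c * lookup v M"
proof -
  have "scal c v = Poly_Mapping.map ((*) c) v"
    by (simp add: scal_def Poly_Mapping.mult_map_scale_conv_mult)
  then show ?thesis by (simp add: Poly_Mapping.map.rep_eq when_def)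
qed

lemma scal_simps [simp]:
  "scal c 0 = 0" "scal 0 v = 0" "scal 1 v = v" "scal c (scal d v) = scal (c * d) v"
  by (simp_all add: scal_def mult.assoc [symmetric] mult_single)

lemma scal_add_right: "scal c (u + v) = scal c u + scal c v"
  by (simp add: scal_def algebra_simps)

lemma scal_add_left: "scal (c + d) v = scal c v + scal d v"
  by (simp add: scal_def algebra_simps single_add)

lemma scal_diff_left: "scal (c - d) v = scal c v - scal d v"
  by (simp add: scal_def algebra_simps single_diff)

lemma scal_diff_right: "scal c (u - v) = scal c u - scal c v"
  by (simp add: scal_def algebra_simps)

lemma scal_sum_right: "scal c (sum F I) = (\<Sum>i\<in>I. scal c (F i))"
  by (simp add: scal_def sum_distrib_left)

lemma scal_mult: "scal c u * v = scal c (u * v)" "u * scal c v = scal c (u * v)"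
  by (simp_all add: scal_def mult_ac)

lemma scal_minus: "scal (- c) v = - scal c v"
  by (rule poly_mapping_eqI) simp

lemma lookup_single_mult:
  fixes v :: "'i fock"
  shows "lookup (Poly_Mapping.single N 1 * v) M = (if N \<subseteq># M then lookup v (M - N) else 0)"
proof -
  have "lookup (Poly_Mapping.single N 1 * v) M =
     (\<Sum>l. lookup (Poly_Mapping.single N (1::complex)) l * (\<Sum>q. lookup v q when M = l + q))"
    by (rule lookup_mult)
  also have "\<dots> = (\<Sum>l. (\<Sum>q. lookup v q when M = l + q) when l = N)"
    by (rule Sum_any.cong) (simp add: lookup_single when_def)
  also have "\<dots> = (\<Sum>q. lookup v q when M = N + q)" by simp
  also have "\<dots> = (if N \<subseteq># M then lookup v (M - N) else 0)"
  proof (cases "N \<subseteq># M")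
    case True
    then have "(M = N + q) = (q = M - N)" for q
      by auto
    then show ?thesis using True by simp
  next
    case False
    then have "M \<noteq> N + q" for q
      by auto
    then show ?thesis using False by simp
  qed
  finally show ?thesis .
qed

lemma lookup_var_mult:
  "lookup (var x * v) M = (if x \<in># M then lookup v (M - {#x#}) else 0)"
  by (simp add: var_def lookup_single_mult)

text \<open>The derivative, defined as a sum over the support, is a formula in each coefficient. Linearity, the
  Leibniz rule and commutation of derivatives are read off coefficientwise from this.\<close>

lemma lookup_pdiff: "lookup (pdiff x v) M = of_nat (Suc (count M x)) * lookup v (add_mset x M)"
proof -
  have "lookup (pdiff x v) M = (\<Sum>N\<in>Poly_Mapping.keys v.
     if N - {#x#} = M then of_nat (count N x) * lookup v N else 0)"
    by (simp add: pdiff_def lookup_sum lookup_single when_def)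
  also have "\<dots> = (\<Sum>N\<in>Poly_Mapping.keys v.
     if N = add_mset x M then of_nat (Suc (count M x)) * lookup v (add_mset x M) else 0)"
  proof (rule sum.cong[OF refl])
    fix N
    show "(if N - {#x#} = M then of_nat (count N x) * lookup v N else 0) =
       (if N = add_mset x M then of_nat (Suc (count M x)) * lookup v (add_mset x M) else 0)"
      by (cases "x \<in># N") (auto simp: not_in_iff dest!: multi_member_split)
  qed
  also have "\<dots> = of_nat (Suc (count M x)) * lookup v (add_mset x M)"
    by (auto simp: sum.delta not_in_keys_iff_lookup_eq_zero in_keys_iff)
  finally show ?thesis .
qed

definition fock_linear :: "('i fock \<Rightarrow> 'j fock) \<Rightarrow> bool" where
  "fock_linear A \<longleftrightarrow> (\<forall>u v. A (u + v) = A u + A v) \<and> (\<forall>c v. A (scal c v) = scal c (A v))"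

lemma fock_linearI:
  assumes "\<And>u v. A (u + v) = A u + A v" and "\<And>c v. A (scal c v) = scal c (A v)"
  shows "fock_linear A"
  using assms by (simp add: fock_linear_def)

lemma
  assumes "fock_linear A"
  shows fock_linear_add: "A (u + v) = A u + A v"
    and fock_linear_scal: "A (scal c v) = scal c (A v)"
    and fock_linear_0: "A 0 = 0"
    and fock_linear_minus: "A (- u) = - A u"
    and fock_linear_diff: "A (u - v) = A u - A v"
    and fock_linear_sum: "A (sum F I) = (\<Sum>i\<in>I. A (F i))"
proof -
  show add: "A (u + v) = A u + A v" for u v
    using assms by (simp add: fock_linear_def)
  show sc: "A (scal c v) = scal c (A v)" for c v
    using assms by (simp add: fock_linear_def)
  show z: "A 0 = 0"
    using sc[of 0 0] by simp
  show m: "A (- u) = - A u" for u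
    using sc[of "-1" u] by (simp add: scal_minus)
  show "A (u - v) = A u - A v"
    using add[of u "- v"] by (simp add: m)
  show "A (sum F I) = (\<Sum>i\<in>I. A (F i))"
    by (induction I rule: infinite_finite_induct) (simp_all add: z add)
qed

lemma fock_linear_foldr:
  assumes "\<And>m. m \<in> set ms \<Longrightarrow> fock_linear (X m)"
  shows "fock_linear (foldr X ms)"
  using assms
proof (induction ms)
  case (Cons m ms)
  then have "fock_linear (X m)" "fock_linear (foldr X ms)" by auto
  then show ?case
    by (auto intro!: fock_linearI simp: fock_linear_add fock_linear_scal)
qed (simp add: fock_linear_def)

lemma foldr_scal:
  assumes "\<And>m. fock_linear (X m)"
  shows "foldr (\<lambda>m u. scal (\<phi> m) (X m u)) ms v = scal (prod_list (map \<phi> ms)) (foldr X ms v)"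
  by (induction ms) (simp_all add: fock_linear_scal[OF assms])

lemma fock_linear_pdiff: "fock_linear (pdiff x)"
  by (rule fock_linearI; rule poly_mapping_eqI)
     (simp_all add: lookup_pdiff lookup_add algebra_simps del: of_nat_Suc)

lemma fock_linear_heis [simp]: "fock_linear (heis C i n)"
  by (auto intro!: fock_linearI simp: heis_def algebra_simps scal_mult scal_add_right mult.commute
      fock_linear_add[OF fock_linear_pdiff] fock_linear_scal[OF fock_linear_pdiff])

lemma heis_neg: "m > 0 \<Longrightarrow> heis C i (- int m) v = var (i, m - 1) * v"
  by (simp add: heis_def)

lemma heis_pos: "m > 0 \<Longrightarrow> heis C i (int m) v = scal (C m) (pdiff (i, m - 1) v)"
  by (simp add: heis_def)

lemma pdiff_var_mult: "pdiff x (var y * v) = (if x = y then v else 0) + var y * pdiff x v"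
proof (rule poly_mapping_eqI)
  fix M
  show "lookup (pdiff x (var y * v)) M = lookup ((if x = y then v else 0) + var y * pdiff x v) M"
  proof (cases "y \<in># M")
    case True
    then obtain N where "M = add_mset y N" by (auto dest: multi_member_split)
    then show ?thesis
      by (auto simp: lookup_pdiff lookup_var_mult lookup_add distrib_right add_mset_commute)
  next
    case False
    then show ?thesis
      by (auto simp: lookup_pdiff lookup_var_mult lookup_add count_eq_zero_iff[THEN iffD2])
  qed
qed

lemma pdiff_1: "pdiff x 1 = 0"
  by (rule poly_mapping_eqI) (simp add: lookup_pdiff lookup_one when_def)

lemma pdiff_commute: "pdiff x (pdiff y v) = pdiff y (pdiff x v)"
  by (rule poly_mapping_eqI) (auto simp: lookup_pdiff add_mset_commute)

text \<open>Every polynomial is reached from \<open>1\<close> by linear combinations and multiplication by variables. With this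
  induction, identities between operators built from derivatives and substitutions need only be checked
  on the commutation with a variable.\<close>

lemma fock_induct [case_names one scal add var]:
  fixes v :: "'i fock"
  assumes one: "P 1" and sc: "\<And>c u. P u \<Longrightarrow> P (scal c u)"
    and add: "\<And>u w. P u \<Longrightarrow> P w \<Longrightarrow> P (u + w)" and var: "\<And>x u. P u \<Longrightarrow> P (var x * u)"
  shows "P v"
proof -
  have mono: "P (Poly_Mapping.single M 1)" for M
  proof (induction M)
    case empty
    then show ?case using one by simp
  next
    case (add x M)
    then show ?case using var[of "Poly_Mapping.single M 1" x]
      by (simp add: var_def mult_single)
  qed
  show ?thesis
  proof (induction v rule: update_induct)
    case const
    show ?case using sc[OF one, of 0] by simp
  next
    case (update u M c)
    then have "Poly_Mapping.update M c u = u + scal c (Poly_Mapping.single M 1)"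
      by (intro poly_mapping_eqI)
        (auto simp: lookup_update lookup_add lookup_single when_def in_keys_iff)
    then show ?case using add[OF update(3) sc[OF mono[of M], of c]] by simp
  qed
qed

lemma subst_eq_sum:
  assumes "finite S" "Poly_Mapping.keys v \<subseteq> S"
  shows "subst \<phi> v = (\<Sum>M\<in>S. scal (lookup v M) (\<Prod>x\<in>#M. \<phi> x))"
  unfolding subst_def
  by (rule sum.mono_neutral_left) (use assms in \<open>auto simp: in_keys_iff\<close>)

lemma fock_linear_subst [simp]: "fock_linear (subst \<phi>)"
proof (rule fock_linearI)
  fix u v :: "'a fock" and c
  let ?S = "Poly_Mapping.keys u \<union> Poly_Mapping.keys v"
  have "Poly_Mapping.keys (u + v) \<subseteq> ?S" by (rule keys_add)
  then show "subst \<phi> (u + v) = subst \<phi> u + subst \<phi> v"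
    by (simp add: subst_eq_sum[of ?S] lookup_add scal_add_left sum.distrib)
  have "Poly_Mapping.keys (scal c v) \<subseteq> Poly_Mapping.keys v" by (auto simp: in_keys_iff)
  then show "subst \<phi> (scal c v) = scal c (subst \<phi> v)"
    by (simp add: subst_eq_sum[of "Poly_Mapping.keys v"] scal_sum_right)
qed

lemma subst_1 [simp]: "subst \<phi> 1 = 1"
  by (simp add: subst_def)

lemma subst_var_mult: "subst \<phi> (var x * v) = \<phi> x * subst \<phi> v"
proof -
  have *: "Poly_Mapping.keys (var x * v) = add_mset x ` Poly_Mapping.keys v"
  proof (intro set_eqI)
    fix M show "M \<in> Poly_Mapping.keys (var x * v) \<longleftrightarrow> M \<in> add_mset x ` Poly_Mapping.keys v"
      by (cases "x \<in># M") (auto simp: in_keys_iff lookup_var_mult dest!: multi_member_split)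
  qed
  have "subst \<phi> (var x * v) = (\<Sum>M\<in>Poly_Mapping.keys v. scal (lookup v M) (\<phi> x * (\<Prod>x\<in>#M. \<phi> x)))"
    unfolding subst_def * by (subst sum.reindex) (auto simp: inj_on_def lookup_var_mult)
  also have "\<dots> = \<phi> x * subst \<phi> v"
    by (simp add: subst_def sum_distrib_left scal_mult)
  finally show ?thesis .
qed

lemma subst_var: "subst \<phi> (var x) = \<phi> x"
  using subst_var_mult[of \<phi> x 1] by simp

text \<open>The degree in one species only: an operator of one species leaves the degree in the other alone,
  so that the modes of a current of one species act as finite sums even on vectors that were produced
  by the other current.\<close>

definition weight :: "'i \<Rightarrow> ('i \<times> nat) multiset \<Rightarrow> nat" where
  "weight i M = (\<Sum>x\<in>#M. if fst x = i then Suc (snd x) else 0)"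

text \<open>The bound is an integer because lowering it below zero forces the vector to vanish, which is how
  products of annihilation operators are seen to kill a vector.\<close>

definition deg_le :: "'i \<Rightarrow> int \<Rightarrow> 'i fock \<Rightarrow> bool" where
  "deg_le i d v \<longleftrightarrow> (\<forall>M. lookup v M \<noteq> 0 \<longrightarrow> int (weight i M) \<le> d)"

lemma deg_le_neg: "deg_le i d v \<Longrightarrow> d < 0 \<Longrightarrow> v = 0"
  by (rule poly_mapping_eqI) (force simp: deg_le_def)

lemma weight_add_mset: "weight i (add_mset x M) = weight i M + (if fst x = i then Suc (snd x) else 0)"
  by (simp add: weight_def)

lemma deg_le_exists: "\<exists>d::nat. \<forall>i. deg_le i (int d) v"
proof -
  define w where "w = (\<lambda>M :: ('a \<times> nat) multiset. \<Sum>x\<in>#M. Suc (snd x))"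
  define d where "d = Max (insert 0 (w ` Poly_Mapping.keys v))"
  have "weight i M \<le> w M" for i M
    unfolding weight_def w_def by (rule sum_mset_mono) auto
  moreover have "w M \<le> d" if "lookup v M \<noteq> 0" for M
    unfolding d_def using that by (intro Max_ge) (auto simp: in_keys_iff)
  ultimately show ?thesis
    unfolding deg_le_def by (meson le_trans of_nat_le_iff)
qed

lemma deg_le_heis:
  assumes "deg_le i d v"
  shows "deg_le i (if j = i then d - n else d) (heis C j n v)"
  unfolding deg_le_def
proof (intro allI impI)
  fix M assume nz: "lookup (heis C j n v) M \<noteq> 0"
  consider "n < 0" | "n > 0" | "n = 0" by linarith
  then show "int (weight i M) \<le> (if j = i then d - n else d)"
  proof cases
    case 1
    let ?x = "(j, nat (- n) - 1)"
    have "?x \<in># M" "lookup v (M - {#?x#}) \<noteq> 0"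
      using nz 1 by (auto simp: heis_def lookup_var_mult split: if_splits)
    then obtain N where N: "M = add_mset ?x N" "lookup v N \<noteq> 0"
      by (auto dest!: multi_member_split)
    then have "int (weight i N) \<le> d" using assms by (auto simp: deg_le_def)
    with N 1 show ?thesis by (auto simp: weight_add_mset)
  next
    case 2
    let ?x = "(j, nat n - 1)"
    have "lookup v (add_mset ?x M) \<noteq> 0"
      using nz 2 by (auto simp: heis_def lookup_pdiff)
    then have "int (weight i (add_mset ?x M)) \<le> d" using assms by (auto simp: deg_le_def)
    with 2 show ?thesis by (auto simp: weight_add_mset)
  next
    case 3
    with nz show ?thesis by (simp add: heis_def)
  qed
qed

section \<open>Normally ordered exponentials as finite sums of words\<close>

definition comps :: "nat \<Rightarrow> nat list set" where
  "comps n = {ms. 0 \<notin> set ms \<and> sum_list ms = n}"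

lemma finite_comps [simp]: "finite (comps n)"
proof (rule finite_subset)
  have "set ms \<subseteq> {..n} \<and> length ms \<le> n" if "0 \<notin> set ms" "sum_list ms = n" for ms
  proof
    show "set ms \<subseteq> {..n}"
      using member_le_sum_list[of _ ms] that by auto
    show "length ms \<le> n"
      using that
    proof (induction ms arbitrary: n)
      case (Cons m ms)
      then show ?case using Cons.IH[of "sum_list ms"] by (cases m) auto
    qed simp
  qed
  then show "comps n \<subseteq> {ms. set ms \<subseteq> {..n} \<and> length ms \<le> n}"
    by (auto simp: comps_def)
  show "finite {ms. set ms \<subseteq> {..n} \<and> length ms \<le> n}"
    by (rule finite_lists_length_le) simp
qed

text \<open>The pair \<open>(ms, ls)\<close> stands for the normally ordered product with creation operators of modes \<open>-m\<close>,
  \<open>m\<close> in \<open>ms\<close>, to the left of annihilation operators of modes \<open>l\<close> in \<open>ls\<close>. The entries are the modes up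
  to sign, \<open>n\<close> is the total mode and \<open>d\<close> is the degree above which annihilators act as zero.\<close>

definition words :: "int \<Rightarrow> int \<Rightarrow> (nat list \<times> nat list) set" where
  "words d n = {(ms, ls). 0 \<notin> set ms \<and> 0 \<notin> set ls
     \<and> int (sum_list ls) - int (sum_list ms) = n \<and> int (sum_list ls) \<le> d}"

lemma finite_degree_pairs: "finite {(j, k). int k - int j = n \<and> int k \<le> d}"
proof (rule finite_subset)
  show "{(j, k). int k - int j = n \<and> int k \<le> d} \<subseteq> {..nat (d - n)} \<times> {..nat d}"
    by auto
qed simp

lemma finite_words [simp]: "finite (words d n)"
proof (rule finite_subset)
  show "words d n \<subseteq> (\<Union>(j, k)\<in>{(j, k). int k - int j = n \<and> int k \<le> d}. comps j \<times> comps k)"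
    by (auto simp: words_def comps_def)
  show "finite (\<Union>(j, k)\<in>{(j, k). int k - int j = n \<and> int k \<le> d}. comps j \<times> comps k)"
    using finite_degree_pairs by auto
qed

definition word :: "(nat \<Rightarrow> complex) \<Rightarrow> 'i \<Rightarrow> nat list \<Rightarrow> nat list \<Rightarrow> 'i fock \<Rightarrow> 'i fock" where
  "word C i ms ls v =
     foldr (\<lambda>m. heis C i (- int m)) ms (foldr (\<lambda>m. heis C i (int m)) ls v)"

text \<open>The coefficient that \<open>:exp (\<Sum>m\<noteq>0. \<phi> m c\<^sub>m z\<^sup>-\<^sup>m):\<close> gives to a word; the factorials come from the two
  exponential series.\<close>

definition word_weight :: "(int \<Rightarrow> complex) \<Rightarrow> nat list \<Rightarrow> nat list \<Rightarrow> complex" where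
  "word_weight \<phi> ms ls =
     (\<Prod>m\<leftarrow>ms. \<phi> (- int m)) * (\<Prod>m\<leftarrow>ls. \<phi> (int m)) / (fact (length ms) * fact (length ls))"

lemma fock_linear_word [simp]: "fock_linear (word C i ms ls)"
proof -
  have "fock_linear (foldr (\<lambda>m. heis C i (- int m)) ms)" "fock_linear (foldr (\<lambda>m. heis C i (int m)) ls)"
    by (auto intro!: fock_linear_foldr)
  then show ?thesis
    by (auto simp: word_def fock_linear_add fock_linear_scal intro!: fock_linearI)
qed

lemma deg_le_annihilators:
  assumes "deg_le i d v"
  shows "deg_le i (d - int (sum_list ls)) (foldr (\<lambda>m. heis C i (int m)) ls v)"
proof (induction ls)
  case Nil
  then show ?case using assms by simp
next
  case (Cons l ls)
  then show ?case
    using deg_le_heis[OF Cons, of i "int l" C] by (simp add: algebra_simps)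
qed

lemma annihilators_eq_0:
  assumes "deg_le i d v" "int (sum_list ls) > d"
  shows "foldr (\<lambda>m. heis C i (int m)) ls v = 0"
  using deg_le_neg[OF deg_le_annihilators[OF assms(1), of ls C]] assms(2) by simp

lemma deg_le_word_other:
  assumes "deg_le i d v" "j \<noteq> i"
  shows "deg_le i d (word C j ms ls v)"
proof -
  have *: "deg_le i d (foldr (\<lambda>m. heis C j (\<sigma> m)) ls v)" if "deg_le i d v" for \<sigma> :: "nat \<Rightarrow> int" and ls v
    by (induction ls) (use deg_le_heis[of i d _ j _ C] assms(2) that in auto)
  show ?thesis unfolding word_def by (intro * assms)
qed

lemma exp_mode_eq:
  assumes "\<And>m. fock_linear (X m)"
  shows "exp_mode (\<lambda>m u. scal (\<phi> m) (X m u)) n v =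
    (\<Sum>ms\<in>comps n. scal ((\<Prod>m\<leftarrow>ms. \<phi> m) / fact (length ms)) (foldr X ms v))"
  unfolding exp_mode_def comps_def by (simp add: foldr_scal[OF assms])

text \<open>Grouping the words by the pair of total degrees of the two factors recovers the double sum over
  \<open>(j, k)\<close>. On a vector of bounded degree only finitely many words survive, and the scalars \<open>\<phi>\<close> have
  become coefficients of fixed vectors, so that limits in parameters of \<open>\<phi>\<close> are limits of scalars.\<close>

lemma nexp_mode_eq:
  assumes "deg_le i d v"
  shows "nexp_mode (\<lambda>m u. scal (\<phi> m) (heis C i m u)) n v =
    (\<Sum>(ms, ls)\<in>words d n. scal (word_weight \<phi> ms ls) (word C i ms ls v))"
proof -
  let ?J = "{(j, k). int k - int j = n \<and> int k \<le> d}"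
  let ?c = "\<lambda>m u. scal (\<phi> m) (heis C i m u)"
  let ?F = "\<lambda>(ms, ls). scal (word_weight \<phi> ms ls) (word C i ms ls v)"
  have pos: "exp_mode (\<lambda>m. ?c (int m)) k v = (\<Sum>ls\<in>comps k. scal ((\<Prod>m\<leftarrow>ls. \<phi> (int m)) / fact (length ls))
      (foldr (\<lambda>m. heis C i (int m)) ls v))" for k
    by (rule exp_mode_eq) simp
  have zero: "exp_mode (\<lambda>m. ?c (int m)) k v = 0" if "int k > d" for k
    unfolding pos by (rule sum.neutral) (use annihilators_eq_0[OF assms] that in \<open>auto simp: comps_def\<close>)
  have neg: "exp_mode (\<lambda>m. ?c (- int m)) j u = (\<Sum>ms\<in>comps j. scal ((\<Prod>m\<leftarrow>ms. \<phi> (- int m)) / fact (length ms))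
      (foldr (\<lambda>m. heis C i (- int m)) ms u))" for j u
    by (rule exp_mode_eq) simp
  have lin: "fock_linear (foldr (\<lambda>m. heis C i (- int m)) ms)" for ms
    by (auto intro!: fock_linear_foldr)
  have zero': "exp_mode (\<lambda>m. ?c (- int m)) j 0 = 0" for j
    unfolding neg by (simp add: fock_linear_0[OF lin])
  have both: "exp_mode (\<lambda>m. ?c (- int m)) j (exp_mode (\<lambda>m. ?c (int m)) k v) = (\<Sum>w\<in>comps j \<times> comps k. ?F w)" for j k
    unfolding neg pos sum.cartesian_product[symmetric]
    by (simp add: fock_linear_sum[OF lin] fock_linear_scal[OF lin] scal_sum_right word_def word_weight_def mult_ac)
  have "nexp_mode ?c n v = (\<Sum>(j, k)\<in>?J. if int k - int j = n
     then exp_mode (\<lambda>m. ?c (- int m)) j (exp_mode (\<lambda>m. ?c (int m)) k v) else 0)"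
    unfolding nexp_mode_def
  proof (rule Sum_any.expand_superset[OF finite_degree_pairs], rule subsetI)
    fix p
    assume "p \<in> {p. (case p of (j, k) \<Rightarrow> if int k - int j = n
       then exp_mode (\<lambda>m. ?c (- int m)) j (exp_mode (\<lambda>m. ?c (int m)) k v) else 0) \<noteq> 0}"
    moreover obtain j k where p: "p = (j, k)" by (cases p)
    ultimately have "(if int k - int j = n
       then exp_mode (\<lambda>m. ?c (- int m)) j (exp_mode (\<lambda>m. ?c (int m)) k v) else 0) \<noteq> 0"
      by (simp only: mem_Collect_eq case_prod_conv simp_thms)
    then have "int k - int j = n" "exp_mode (\<lambda>m. ?c (- int m)) j (exp_mode (\<lambda>m. ?c (int m)) k v) \<noteq> 0"
      by (meson)+
    then have "int k - int j = n" "\<not> int k > d"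
      by (auto simp only: zero zero')
    then show "p \<in> ?J" unfolding p by (simp only: mem_Collect_eq case_prod_conv) linarith
  qed
  also have "\<dots> = (\<Sum>p\<in>?J. \<Sum>w\<in>{w \<in> words d n. (\<lambda>(ms, ls). (sum_list ms, sum_list ls)) w = p}. ?F w)"
  proof (rule sum.cong[OF refl])
    fix p assume "p \<in> ?J"
    then obtain j k where p: "p = (j, k)" "int k - int j = n" "int k \<le> d" by auto
    then have "comps j \<times> comps k = {w \<in> words d n. (\<lambda>(ms, ls). (sum_list ms, sum_list ls)) w = p}"
      by (auto simp: comps_def words_def)
    then show "(case p of (j, k) \<Rightarrow> if int k - int j = n
       then exp_mode (\<lambda>m. ?c (- int m)) j (exp_mode (\<lambda>m. ?c (int m)) k v) else 0) =
       (\<Sum>w\<in>{w \<in> words d n. (\<lambda>(ms, ls). (sum_list ms, sum_list ls)) w = p}. ?F w)"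
      using p by (simp only: case_prod_conv both simp_thms if_True)
  qed
  also have "\<dots> = (\<Sum>w\<in>words d n. ?F w)"
    by (rule sum.group[OF finite_words finite_degree_pairs]) (auto simp: words_def)
  finally show ?thesis .
qed

text \<open>Injectivity makes the two families have the same support. Over an infinite support both sums are zero
  by convention.\<close>

lemma Sum_any_image:
  assumes "fock_linear \<Phi>" "\<And>u. \<Phi> u = 0 \<Longrightarrow> u = 0"
  shows "\<Phi> (Sum_any F) = Sum_any (\<lambda>x. \<Phi> (F x))"
proof -
  have "\<Phi> (F x) \<noteq> 0 \<longleftrightarrow> F x \<noteq> 0" for x
    using assms fock_linear_0 by metis
  then show ?thesis by (simp add: Sum_any.expand_set fock_linear_sum[OF assms(1)])
qed

lemma exp_mode_image:
  assumes "fock_linear \<Phi>" "\<And>m u. \<Phi> (X m u) = Y m (\<Phi> u)"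
  shows "\<Phi> (exp_mode X n v) = exp_mode Y n (\<Phi> v)"
proof -
  have "\<Phi> (foldr X ms v) = foldr Y ms (\<Phi> v)" for ms
    by (induction ms) (simp_all add: assms(2))
  then show ?thesis
    by (simp add: exp_mode_def fock_linear_sum[OF assms(1)] fock_linear_scal[OF assms(1)])
qed

lemma nexp_mode_image:
  assumes "fock_linear \<Phi>" "\<And>u. \<Phi> u = 0 \<Longrightarrow> u = 0" "\<And>m u. \<Phi> (X m u) = Y m (\<Phi> u)"
  shows "\<Phi> (nexp_mode X n v) = nexp_mode Y n (\<Phi> v)"
proof -
  have neg: "\<Phi> (exp_mode (\<lambda>m. X (- int m)) j u) = exp_mode (\<lambda>m. Y (- int m)) j (\<Phi> u)" for j u
    by (rule exp_mode_image[OF assms(1)]) (rule assms(3))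
  have pos: "\<Phi> (exp_mode (\<lambda>m. X (int m)) j u) = exp_mode (\<lambda>m. Y (int m)) j (\<Phi> u)" for j u
    by (rule exp_mode_image[OF assms(1)]) (rule assms(3))
  have "\<Phi> (case p of (j, k) \<Rightarrow> if int k - int j = n
      then exp_mode (\<lambda>m. X (- int m)) j (exp_mode (\<lambda>m. X (int m)) k v) else 0) =
    (case p of (j, k) \<Rightarrow> if int k - int j = n
      then exp_mode (\<lambda>m. Y (- int m)) j (exp_mode (\<lambda>m. Y (int m)) k (\<Phi> v)) else 0)" for p
    by (simp only: if_distrib[of \<Phi>] neg pos fock_linear_0[OF assms(1)] split: prod.split) simp
  then show ?thesis
    unfolding nexp_mode_def by (subst Sum_any_image[OF assms(1,2)]) (auto intro: Sum_any.cong)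
qed

section \<open>The oscillators that do not depend on the scaling parameter\<close>

text \<open>A substitution intertwines two first-order operators as soon as their commutators with the
  generators are the same scalars. This turns equality of commutation relations into equality of
  operators.\<close>

lemma subst_intertwines:
  assumes "fock_linear A" "fock_linear B" "A 1 = 0" "B 1 = 0"
    and A: "\<And>z u. A (\<rho> z * u) = scal (\<kappa> z) u + \<rho> z * A u"
    and B: "\<And>z u. B (var z * u) = scal (\<kappa> z) u + var z * B u"
  shows "subst \<rho> (B v) = A (subst \<rho> v)"
proof (induction v rule: fock_induct)
  case one
  then show ?case using assms fock_linear_0[OF fock_linear_subst] by simp
next
  case (scal c u)
  then show ?case using assms(1,2) by (simp add: fock_linear_scal)
next
  case (add u w)
  then show ?case using assms(1,2) by (simp add: fock_linear_add)
next
  case (var x u)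
  then show ?case
    by (simp add: A B subst_var_mult fock_linear_add[OF fock_linear_subst]
        fock_linear_scal[OF fock_linear_subst])
qed

lemma subst_left_inverse:
  assumes "\<And>z u. subst \<rho>' (\<rho> z * u) = var z * subst \<rho>' u"
  shows "subst \<rho>' (subst \<rho> v) = v"
  by (induction v rule: fock_induct)
    (simp_all add: subst_var_mult assms fock_linear_add[OF fock_linear_subst]
        fock_linear_scal[OF fock_linear_subst])

text \<open>All annihilation operators of the tensor product, diagonal or barred, have this form.\<close>

definition leg_diff :: "complex \<Rightarrow> complex \<Rightarrow> nat \<Rightarrow> leg fock \<Rightarrow> leg fock" where
  "leg_diff s t j u = scal s (pdiff (First, j) u) + scal t (pdiff (Second, j) u)"

lemma fock_linear_leg_diff: "fock_linear (leg_diff s t j)"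
  by (auto intro!: fock_linearI simp: leg_diff_def scal_add_right fock_linear_add[OF fock_linear_pdiff]
      fock_linear_scal[OF fock_linear_pdiff] mult_ac)

lemma leg_diff_1: "leg_diff s t j 1 = 0"
  by (simp add: leg_diff_def pdiff_1)

lemma leg_diff_mult:
  "leg_diff s t j ((scal x (var (First, k)) + scal y (var (Second, k))) * u) =
     scal (if k = j then s * x + t * y else 0) u
     + (scal x (var (First, k)) + scal y (var (Second, k))) * leg_diff s t j u"
  by (auto simp: leg_diff_def fock_linear_add[OF fock_linear_pdiff] fock_linear_scal[OF fock_linear_pdiff]
      pdiff_var_mult distrib_right distrib_left scal_mult scal_add_right scal_add_left
      mult_ac[where 'a = complex] add_ac)

definition b :: "int \<Rightarrow> osc fock \<Rightarrow> osc fock" where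
  "b n = heis (\<lambda>m. of_nat m / 2) Bar n"

text \<open>The common value of \<open>[barH\<^sub>m / [2m], barH\<^sub>-\<^sub>m / [-2m]]\<close> and of \<open>[\<alpha>\<^sub>m, \<alpha>\<^sub>-\<^sub>m]\<close> without its elliptic factor.\<close>

definition bracket :: "complex \<Rightarrow> complex \<Rightarrow> nat \<Rightarrow> complex" where
  "bracket r h m =
     - (qq r h ^ m + inverse (qq r h ^ m)) * hcomm r h m / qint r h (2 * int m) ^ 2"

definition unit_scale :: "complex \<Rightarrow> complex \<Rightarrow> complex" where
  "unit_scale r h = csqrt (beta r) * h"

text \<open>The factor between an original oscillator and the rescaled one of the same mode. For creation
  operators it is prescribed; for annihilation operators it is forced by \<open>[a\<^sub>m, a\<^sub>-\<^sub>m] = m / 2\<close>. For the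
  annihilation modes of \<open>\<alpha>\<close> the elliptic factor comes on top of it.\<close>

definition osc_scale :: "complex \<Rightarrow> (nat \<Rightarrow> complex \<Rightarrow> complex) \<Rightarrow> complex \<Rightarrow> int \<Rightarrow> complex" where
  "osc_scale r f h n =
     (if n < 0 then unit_scale r h * f (nat (- n)) h
      else 2 / of_int n * bracket r h (nat n) / (unit_scale r h * f (nat n) h))"

text \<open>The elliptic factor of \<open>\<Delta>Z(z)\<close>. Apart from it, the diagonal and the barred oscillators obey the same
  commutation relations.\<close>

definition dressing :: "complex \<Rightarrow> complex \<Rightarrow> complex \<Rightarrow> int \<Rightarrow> complex" where
  "dressing r \<tau> h n = (if n < 0 then 1 else
     (qq r h powi (- 2 * n) - pp \<tau> ^ nat n * qq r h powi (2 * n)) / (1 - pp \<tau> ^ nat n))"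

definition osc_DeltaZ where
  "osc_DeltaZ r \<tau> f h n =
     nexp_mode (\<lambda>m u. scal (dressing r \<tau> h m * osc_scale r f h m) (a m u)) n"

definition osc_TDV where
  "osc_TDV r \<pi> g h n v =
     scal (xpow r h \<pi>) (nexp_mode (\<lambda>m u. scal (qq r h powi (- m) * osc_scale r g h m) (b m u)) n v)
   + scal (xpow r h (- \<pi>)) (nexp_mode (\<lambda>m u. scal (- (qq r h powi m * osc_scale r g h m)) (b m u)) n v)"

text \<open>What holds for all \<open>h\<close> close to zero along the filter of the limit, by the hypotheses on \<open>f\<close> and \<open>g\<close>.\<close>

locale generic_parameters =
  fixes r \<tau> h :: complex and f g :: "nat \<Rightarrow> complex \<Rightarrow> complex"
  assumes beta_nz: "beta r \<noteq> 0" and h_nz: "h \<noteq> 0"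
    and q_root: "\<And>m. m > 0 \<Longrightarrow> qq r h ^ m \<noteq> 1"
    and f_nz: "\<And>m. m > 0 \<Longrightarrow> f m h \<noteq> 0" and g_nz: "\<And>m. m > 0 \<Longrightarrow> g m h \<noteq> 0"
begin

abbreviation "Q m \<equiv> qq r h ^ m"

lemma q_nz: "qq r h \<noteq> 0"
  by (simp add: qq_def xpow_def)

lemma unit_scale_nz: "unit_scale r h \<noteq> 0"
  using beta_nz h_nz by (simp add: unit_scale_def)

lemma q_diff_nz: "qq r h - inverse (qq r h) \<noteq> 0"
  using q_root[of 2] q_nz by (auto simp: field_simps power2_eq_square)

lemma qint_nz:
  assumes "m > 0"
  shows "qint r h (2 * int m) \<noteq> 0"
proof -
  have "qq r h powi (2 * int m) = Q (2 * m)" "qq r h powi (- (2 * int m)) = inverse (Q (2 * m))"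
    by (simp_all add: power_int_minus flip: power_int_of_nat)
  moreover have "Q (2 * m) \<noteq> inverse (Q (2 * m))"
  proof
    assume "Q (2 * m) = inverse (Q (2 * m))"
    then have "Q (2 * m) * Q (2 * m) = 1" using q_nz by (simp add: field_simps)
    then have "Q (4 * m) = 1" by (simp flip: power_add)
    then show False using q_root[of "4 * m"] assms by simp
  qed
  ultimately show ?thesis using q_diff_nz by (simp add: qint_def)
qed

lemma qint_minus: "qint r h (- n) = - qint r h n"
  by (simp add: qint_def minus_divide_left)

text \<open>Up to sign, this is the determinant that expresses the diagonal and barred creation operators by
  those of the two factors.\<close>

lemma det_nz:
  assumes "m > 0"
  shows "1 + Q m * Q m \<noteq> 0"
proof
  assume "1 + Q m * Q m = 0"
  then have "Q m * Q m = - 1" by (simp add: eq_neg_iff_add_eq_0 add.commute)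
  then have "(Q m * Q m) * (Q m * Q m) = 1" by simp
  moreover have "4 * m = (m + m) + (m + m)" by simp
  ultimately have "Q (4 * m) = 1" by (simp only: power_add)
  then show False using q_root[of "4 * m"] assms by simp
qed

definition \<rho> :: "osc \<times> nat \<Rightarrow> leg fock" where
  "\<rho> z = (case z of
     (Diag, k) \<Rightarrow> scal (- 1 / (unit_scale r h * f (Suc k) h * qint r h (2 * int (Suc k))))
        (var (First, k) + scal (Q (Suc k)) (var (Second, k)))
   | (Bar, k) \<Rightarrow> scal (- 1 / (unit_scale r h * g (Suc k) h * qint r h (2 * int (Suc k))))
        (scal (Q (Suc k)) (var (First, k)) - var (Second, k)))"

lemma DeltaH_creation: "m > 0 \<Longrightarrow>
    DeltaH r h (- int m) u = (var (First, m - 1) + scal (Q m) (var (Second, m - 1))) * u"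
  by (simp add: DeltaH_def H_def heis_neg distrib_right scal_mult)

lemma barH_creation: "m > 0 \<Longrightarrow>
    barH r h (- int m) u = (scal (Q m) (var (First, m - 1)) - var (Second, m - 1)) * u"
  by (simp add: barH_def H_def heis_neg left_diff_distrib scal_mult)

lemma alpha_creation: "m > 0 \<Longrightarrow>
    alpha r \<tau> h (- int m) u = scal (- 1 / qint r h (2 * int m))
      ((var (First, m - 1) + scal (Q m) (var (Second, m - 1))) * u)"
  by (simp add: alpha_def DeltaH_creation)

lemma rescale_eq: "rescale r \<tau> f g h = subst \<rho>"
proof -
  have "(\<lambda>(s, k). let m = Suc k in case s of
       Diag \<Rightarrow> scal (1 / (csqrt (beta r) * h * f m h)) (alpha r \<tau> h (- int m) 1)
     | Bar \<Rightarrow> scal (1 / (csqrt (beta r) * h * g m h) / qint r h (- 2 * int m))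
                 (barH r h (- int m) 1)) = \<rho>"
  proof (rule ext, clarify)
    fix s k
    show "(let m = Suc k in case s of
       Diag \<Rightarrow> scal (1 / (csqrt (beta r) * h * f m h)) (alpha r \<tau> h (- int m) 1)
     | Bar \<Rightarrow> scal (1 / (csqrt (beta r) * h * g m h) / qint r h (- 2 * int m))
                 (barH r h (- int m) 1)) = \<rho> (s, k)"
      using alpha_creation[of "Suc k" 1] barH_creation[of "Suc k" 1] qint_minus[of "2 * int (Suc k)"]
      by (cases s) (simp_all add: \<rho>_def Let_def unit_scale_def mult_ac del: of_nat_Suc)
  qed
  then show ?thesis by (simp add: rescale_def)
qed

text \<open>Inverting the two-by-two matrices gives a substitution the other way, hence injectivity. The operators
  to be transported preserve the image, as they are shown below to come from explicit operators.\<close>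

lemma rescale_left_inverse: "\<exists>\<rho>'. \<forall>v. subst \<rho>' (rescale r \<tau> f g h v) = v"
proof -
  define u where "u = (\<lambda>k. unit_scale r h * f (Suc k) h * qint r h (2 * int (Suc k)))"
  define w where "w = (\<lambda>k. unit_scale r h * g (Suc k) h * qint r h (2 * int (Suc k)))"
  define \<rho>' :: "leg \<times> nat \<Rightarrow> osc fock" where "\<rho>' z = (case z of
      (First, k) \<Rightarrow> scal (- 1 / (1 + Q (Suc k) * Q (Suc k)))
         (scal (u k) (var (Diag, k)) + scal (Q (Suc k) * w k) (var (Bar, k)))
    | (Second, k) \<Rightarrow> scal (- 1 / (1 + Q (Suc k) * Q (Suc k)))
         (scal (Q (Suc k) * u k) (var (Diag, k)) - scal (w k) (var (Bar, k))))" for z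
  have nz: "u k \<noteq> 0" "w k \<noteq> 0" "1 + Q (Suc k) * Q (Suc k) \<noteq> 0" for k
    using unit_scale_nz f_nz[of "Suc k"] g_nz[of "Suc k"] qint_nz[of "Suc k"] det_nz[of "Suc k"]
    by (simp_all add: u_def w_def del: of_nat_Suc power_Suc)
  note lin = fock_linear_add[OF fock_linear_subst] fock_linear_diff[OF fock_linear_subst]
    fock_linear_scal[OF fock_linear_subst]
  have "subst \<rho>' (\<rho> z * v) = var z * subst \<rho>' v" for z v
  proof -
    obtain s k where z: "z = (s, k)" by (cases z)
    define S where "S = Q (Suc k)"
    have S: "1 + S * S \<noteq> 0" using nz(3)[of k] by (simp add: S_def)
    have "subst \<rho>' (\<rho> z * v) = subst \<rho>' (\<rho> z) * subst \<rho>' v"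
      unfolding z \<rho>_def
      by (cases s) (simp_all add: lin scal_mult distrib_right left_diff_distrib subst_var_mult subst_var
            scal_add_right scal_diff_right)
    also have "subst \<rho>' (\<rho> z) = var z"
    proof (cases s)
      case Diag
      have "\<rho> z = scal (- 1 / u k) (var (First, k) + scal S (var (Second, k)))"
        by (simp add: z Diag \<rho>_def u_def S_def del: of_nat_Suc power_Suc)
      then have "subst \<rho>' (\<rho> z) = scal (- 1 / u k) (scal (- 1 / (1 + S * S))
         (scal (u k) (var (Diag, k)) + scal (S * w k) (var (Bar, k)))
         + scal S (scal (- 1 / (1 + S * S))
         (scal (S * u k) (var (Diag, k)) - scal (w k) (var (Bar, k)))))"
        by (simp add: lin subst_var \<rho>'_def S_def del: power_Suc)
      also have "\<dots> = var (Diag, k)"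
        using nz(1)[of k] S
        by (intro poly_mapping_eqI) (simp add: lookup_add lookup_minus divide_simps, simp add: algebra_simps)
      finally show ?thesis by (simp add: z Diag)
    next
      case Bar
      have "\<rho> z = scal (- 1 / w k) (scal S (var (First, k)) - var (Second, k))"
        by (simp add: z Bar \<rho>_def w_def S_def del: of_nat_Suc power_Suc)
      then have "subst \<rho>' (\<rho> z) = scal (- 1 / w k) (scal S (scal (- 1 / (1 + S * S))
         (scal (u k) (var (Diag, k)) + scal (S * w k) (var (Bar, k))))
         - scal (- 1 / (1 + S * S))
         (scal (S * u k) (var (Diag, k)) - scal (w k) (var (Bar, k))))"
        by (simp add: lin subst_var \<rho>'_def S_def del: power_Suc)
      also have "\<dots> = var (Bar, k)"
        using nz(2)[of k] S
        by (intro poly_mapping_eqI) (simp add: lookup_add lookup_minus divide_simps, simp add: algebra_simps)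
      finally show ?thesis by (simp add: z Bar)
    qed
    finally show ?thesis .
  qed
  then have "\<forall>v. subst \<rho>' (rescale r \<tau> f g h v) = v"
    by (simp add: rescale_eq subst_left_inverse)
  then show ?thesis by blast
qed

lemma inj_rescale: "inj (rescale r \<tau> f g h)"
  using rescale_left_inverse by (metis injI)

lemma transport_rescale:
  assumes "A (rescale r \<tau> f g h v) = rescale r \<tau> f g h w"
  shows "transport (rescale r \<tau> f g h) A v = w"
  using inj_rescale assms by (simp add: transport_def inv_f_f)

lemma fock_linear_rescale: "fock_linear (rescale r \<tau> f g h)"
  by (simp add: rescale_eq)

lemma rescale_eq_0: "rescale r \<tau> f g h v = 0 \<Longrightarrow> v = 0"
  using inj_rescale fock_linear_0[OF fock_linear_rescale] by (metis injD)

text \<open>For \<open>n > 0\<close> the commutator with a diagonal creation operator is the bracket times the dressing. That with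
  a barred one vanishes, since the contributions of the two tensor factors cancel.\<close>

lemma alpha_rescale:
  "rescale r \<tau> f g h (scal (dressing r \<tau> h n * osc_scale r f h n) (a n v)) =
   alpha r \<tau> h n (rescale r \<tau> f g h v)"
proof -
  consider m where "n = - int m" "m > 0" | m where "n = int m" "m > 0" | "n = 0"
    by (cases n rule: int_cases3) auto
  then show ?thesis
  proof cases
    case 1
    then have "subst \<rho> (scal (osc_scale r f h n) (a n v)) = scal (osc_scale r f h n) (\<rho> (Diag, m - 1) * subst \<rho> v)"
      by (simp add: a_def heis_neg subst_var_mult fock_linear_scal[OF fock_linear_subst])
    then show ?thesis
      using 1 unit_scale_nz f_nz[of m]
      by (simp add: rescale_eq dressing_def alpha_creation \<rho>_def osc_scale_def scal_mult del: power_Suc)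
  next
    case 2
    define S where "S = Q m"
    define c where "c = dressing r \<tau> h n / qint r h (2 * int m) * hcomm r h m"
    have S: "S \<noteq> 0" using q_nz by (simp add: S_def)
    define A where "A = leg_diff (c * inverse S) c (m - 1)"
    define B where "B = (\<lambda>u. scal (dressing r \<tau> h n * osc_scale r f h n) (a n u))"
    have A_alpha: "A = alpha r \<tau> h n"
      using 2 by (auto simp: A_def leg_diff_def fun_eq_iff alpha_def DeltaH_def H_def heis_pos c_def S_def dressing_def
          scal_add_right power_int_minus mult_ac)
    have "subst \<rho> (B v) = A (subst \<rho> v)"
    proof (rule subst_intertwines)
      show "fock_linear A"
        unfolding A_def by (rule fock_linear_leg_diff)
      show "fock_linear B"
        unfolding B_def a_def
        by (auto intro!: fock_linearI simp: scal_add_right fock_linear_add[OF fock_linear_heis]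
            fock_linear_scal[OF fock_linear_heis] mult_ac)
      show "A 1 = 0" by (simp add: A_def leg_diff_1)
      show "B 1 = 0" using 2 by (simp add: B_def a_def heis_pos pdiff_1)
      define \<kappa> where "\<kappa> z = (if z = (Diag, m - 1)
        then dressing r \<tau> h n * bracket r h m / (unit_scale r h * f m h) else 0)" for z
      show "B (var z * u) = scal (\<kappa> z) u + var z * B u" for z u
        using 2 by (auto simp: B_def a_def heis_pos pdiff_var_mult \<kappa>_def osc_scale_def scal_add_right scal_mult)
      show "A (\<rho> z * u) = scal (\<kappa> z) u + \<rho> z * A u" for z u
      proof -
        obtain s k where z: "z = (s, k)" by (cases z)
        have Leibniz: "A ((scal x (var (First, k)) + scal y (var (Second, k))) * u) =
          scal (if k = m - 1 then c * inverse S * x + c * y else 0) u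
          + (scal x (var (First, k)) + scal y (var (Second, k))) * A u" for x y
          unfolding A_def by (rule leg_diff_mult)
        show ?thesis
        proof (cases s)
          case Diag
          define p where "p = - 1 / (unit_scale r h * f (Suc k) h * qint r h (2 * int (Suc k)))"
          have "\<rho> z = scal p (var (First, k)) + scal (p * Q (Suc k)) (var (Second, k))"
            by (simp add: z Diag \<rho>_def p_def scal_add_right del: power_Suc of_nat_Suc)
          moreover have "(if k = m - 1 then c * inverse S * p + c * (p * Q (Suc k)) else 0) = \<kappa> z"
            using 2(2) by (auto simp: \<kappa>_def z Diag c_def p_def S_def bracket_def power2_eq_square divide_inverse
                inverse_mult_distrib algebra_simps
                simp del: power_Suc of_nat_Suc)
          ultimately show ?thesis by (simp only: Leibniz)
        next
          case Bar
          define p where "p = - 1 / (unit_scale r h * g (Suc k) h * qint r h (2 * int (Suc k)))"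
          have "\<rho> z = scal (p * Q (Suc k)) (var (First, k)) + scal (- p) (var (Second, k))"
            by (simp add: z Bar \<rho>_def p_def scal_diff_right scal_minus del: power_Suc of_nat_Suc)
          moreover have "(if k = m - 1 then c * inverse S * (p * Q (Suc k)) + c * (- p) else 0) = \<kappa> z"
            using 2(2) S by (auto simp: \<kappa>_def z Bar S_def simp del: power_Suc)
          ultimately show ?thesis by (simp only: Leibniz)
        qed
      qed
    qed
    then show ?thesis by (simp add: A_alpha B_def rescale_eq)
  next
    case 3
    then show ?thesis
      by (simp add: a_def heis_def alpha_def DeltaH_def H_def fock_linear_0[OF fock_linear_rescale])
  qed
qed

text \<open>The same argument with the two kinds of oscillators exchanged, and without the dressing.\<close>

lemma barH_rescale:
  "rescale r \<tau> f g h (scal (osc_scale r g h n) (b n v)) =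
   scal (1 / qint r h (2 * n)) (barH r h n (rescale r \<tau> f g h v))"
proof -
  consider m where "n = - int m" "m > 0" | m where "n = int m" "m > 0" | "n = 0"
    by (cases n rule: int_cases3) auto
  then show ?thesis
  proof cases
    case 1
    then have "subst \<rho> (scal (osc_scale r g h n) (b n v)) = scal (osc_scale r g h n) (\<rho> (Bar, m - 1) * subst \<rho> v)"
      by (simp add: b_def heis_neg subst_var_mult fock_linear_scal[OF fock_linear_subst])
    then show ?thesis
      using 1 unit_scale_nz g_nz[of m] qint_minus[of "2 * int m"]
      by (simp add: rescale_eq barH_creation \<rho>_def osc_scale_def scal_mult del: power_Suc)
  next
    case 2
    define S where "S = Q m"
    define c where "c = hcomm r h m / qint r h (2 * int m)"
    have S: "S \<noteq> 0" using q_nz by (simp add: S_def)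
    define A where "A = leg_diff c (- c * inverse S) (m - 1)"
    define B where "B = (\<lambda>u. scal (osc_scale r g h n) (b n u))"
    have A_bar: "A = (\<lambda>u. scal (1 / qint r h (2 * n)) (barH r h n u))"
      using 2 by (auto simp: A_def leg_diff_def fun_eq_iff barH_def H_def heis_pos c_def S_def
          scal_diff_right scal_minus power_int_minus mult_ac)
    have "subst \<rho> (B v) = A (subst \<rho> v)"
    proof (rule subst_intertwines)
      show "fock_linear A"
        unfolding A_def by (rule fock_linear_leg_diff)
      show "fock_linear B"
        unfolding B_def b_def
        by (auto intro!: fock_linearI simp: scal_add_right fock_linear_add[OF fock_linear_heis]
            fock_linear_scal[OF fock_linear_heis] mult_ac)
      show "A 1 = 0" by (simp add: A_def leg_diff_1)
      show "B 1 = 0" using 2 by (simp add: B_def b_def heis_pos pdiff_1)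
      define \<kappa> where "\<kappa> z = (if z = (Bar, m - 1)
        then bracket r h m / (unit_scale r h * g m h) else 0)" for z
      show "B (var z * u) = scal (\<kappa> z) u + var z * B u" for z u
        using 2 by (auto simp: B_def b_def heis_pos pdiff_var_mult \<kappa>_def osc_scale_def scal_add_right scal_mult)
      show "A (\<rho> z * u) = scal (\<kappa> z) u + \<rho> z * A u" for z u
      proof -
        obtain s k where z: "z = (s, k)" by (cases z)
        have Leibniz: "A ((scal x (var (First, k)) + scal y (var (Second, k))) * u) =
          scal (if k = m - 1 then c * x + - c * inverse S * y else 0) u
          + (scal x (var (First, k)) + scal y (var (Second, k))) * A u" for x y
          unfolding A_def by (rule leg_diff_mult)
        show ?thesis
        proof (cases s)
          case Diag
          define p where "p = - 1 / (unit_scale r h * f (Suc k) h * qint r h (2 * int (Suc k)))"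
          have "\<rho> z = scal p (var (First, k)) + scal (p * Q (Suc k)) (var (Second, k))"
            by (simp add: z Diag \<rho>_def p_def scal_add_right del: power_Suc of_nat_Suc)
          moreover have "(if k = m - 1 then c * p + - c * inverse S * (p * Q (Suc k)) else 0) = \<kappa> z"
            using 2(2) S by (auto simp: \<kappa>_def z Diag S_def simp del: power_Suc of_nat_Suc)
          ultimately show ?thesis by (simp only: Leibniz)
        next
          case Bar
          define p where "p = - 1 / (unit_scale r h * g (Suc k) h * qint r h (2 * int (Suc k)))"
          have "\<rho> z = scal (p * Q (Suc k)) (var (First, k)) + scal (- p) (var (Second, k))"
            by (simp add: z Bar \<rho>_def p_def scal_diff_right scal_minus del: power_Suc of_nat_Suc)
          moreover have "(if k = m - 1 then c * (p * Q (Suc k)) + - c * inverse S * (- p) else 0) = \<kappa> z"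
            using 2(2) by (auto simp: \<kappa>_def z Bar c_def p_def S_def bracket_def power2_eq_square divide_inverse
                inverse_mult_distrib algebra_simps
                simp del: power_Suc of_nat_Suc)
          ultimately show ?thesis by (simp only: Leibniz)
        qed
      qed
    qed
    then show ?thesis unfolding A_bar B_def rescale_eq .
  next
    case 3
    then show ?thesis
      by (simp add: b_def heis_def barH_def H_def fock_linear_0[OF fock_linear_rescale])
  qed
qed

lemma DeltaZ_rescale:
  "rescale r \<tau> f g h (osc_DeltaZ r \<tau> f h n v) = DeltaZ r \<tau> h n (rescale r \<tau> f g h v)"
  unfolding osc_DeltaZ_def DeltaZ_def
  by (rule nexp_mode_image[where \<Phi> = "rescale r \<tau> f g h"])
    (fact fock_linear_rescale, erule rescale_eq_0, fact alpha_rescale)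

lemma TDV_rescale:
  "rescale r \<tau> f g h (osc_TDV r \<pi> g h n v) = TDV r \<pi> h n (rescale r \<tau> f g h v)"
proof -
  have *: "rescale r \<tau> f g h (scal (c * osc_scale r g h m) (b m u)) =
    scal (c / qint r h (2 * m)) (barH r h m (rescale r \<tau> f g h u))" for c m u
  proof -
    have "rescale r \<tau> f g h (scal (c * osc_scale r g h m) (b m u)) =
        scal c (rescale r \<tau> f g h (scal (osc_scale r g h m) (b m u)))"
      by (simp add: fock_linear_scal[OF fock_linear_rescale])
    also have "\<dots> = scal (c / qint r h (2 * m)) (barH r h m (rescale r \<tau> f g h u))"
      by (simp only: barH_rescale) simp
    finally show ?thesis .
  qed
  have eq: "rescale r \<tau> f g h (nexp_mode (\<lambda>m u. scal (\<gamma> m * osc_scale r g h m) (b m u)) n v) =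
    nexp_mode (\<lambda>m u. scal (\<gamma> m / qint r h (2 * m)) (barH r h m u)) n (rescale r \<tau> f g h v)" for \<gamma>
    by (rule nexp_mode_image[where \<Phi> = "rescale r \<tau> f g h"])
      (fact fock_linear_rescale, erule rescale_eq_0, fact *)
  show ?thesis
    unfolding osc_TDV_def TDV_def fock_linear_add[OF fock_linear_rescale]
      fock_linear_scal[OF fock_linear_rescale] minus_mult_left minus_divide_left
    by (simp only: eq)
qed

lemma transport_TDV: "transport (rescale r \<tau> f g h) (TDV r \<pi> h n) v = osc_TDV r \<pi> g h n v"
  by (rule transport_rescale) (rule TDV_rescale[symmetric])

lemma transport_local_IM1:
  "transport (rescale r \<tau> f g h) (local_IM1 r \<tau> \<pi> h) v =
   Sum_any (\<lambda>n. osc_TDV r \<pi> g h n (osc_DeltaZ r \<tau> f h (- n) v))"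
proof (rule transport_rescale)
  have "rescale r \<tau> f g h (Sum_any (\<lambda>n. osc_TDV r \<pi> g h n (osc_DeltaZ r \<tau> f h (- n) v))) =
     Sum_any (\<lambda>n. rescale r \<tau> f g h (osc_TDV r \<pi> g h n (osc_DeltaZ r \<tau> f h (- n) v)))"
    by (rule Sum_any_image[where \<Phi> = "rescale r \<tau> f g h"])
      (fact fock_linear_rescale, erule rescale_eq_0)
  then show "local_IM1 r \<tau> \<pi> h (rescale r \<tau> f g h v) =
    rescale r \<tau> f g h (Sum_any (\<lambda>n. osc_TDV r \<pi> g h n (osc_DeltaZ r \<tau> f h (- n) v)))"
    by (simp only: local_IM1_def TDV_rescale DeltaZ_rescale)
qed

end

section \<open>Landau estimates near zero\<close>

lemma ILW_le: "ILW r \<le> at 0"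
  by (simp add: ILW_def at_le)

lemma eventually_ILW_nz: "\<forall>\<^sub>F h in ILW r. h \<noteq> 0"
  by (rule filter_leD[OF ILW_le]) (simp add: eventually_at_filter)

lemma eventually_ILW_root: "\<forall>\<^sub>F h in ILW r. \<forall>m>0. qq r h ^ m \<noteq> 1"
  unfolding ILW_def by (simp add: eventually_at_filter)

text \<open>The points \<open>h = 2 r t\<close> with \<open>t\<close> real and positive give \<open>q = e\<^sup>-\<^sup>t\<close>, which is not a root of unity. The
  filter is hence proper, without which expansions would not determine their coefficients.\<close>

lemma ILW_neq_bot:
  assumes "r \<noteq> 0"
  shows "ILW r \<noteq> bot"
proof -
  have "0 islimpt {h. \<forall>m>0. qq r h ^ m \<noteq> 1}"
    unfolding islimpt_approachable
  proof (intro allI impI)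
    fix e :: real assume "e > 0"
    \<comment> \<open>This makes \<open>norm h = e / 2\<close> for \<open>h = 2 r t\<close>.\<close>
    define t where "t = e / (2 * norm (2 * r))"
    have t: "t > 0" using assms \<open>e > 0\<close> by (simp add: t_def)
    define h where "h = of_real t * (2 * r)"
    have "qq r h ^ m \<noteq> 1" if "m > 0" for m
    proof -
      have "qq r h ^ m = of_real (exp (- real m * t))"
        using assms by (simp add: qq_def xpow_def h_def flip: exp_of_nat_mult exp_of_real)
      moreover have "exp (- real m * t) \<noteq> 1" using that t by simp
      ultimately show ?thesis by (metis of_real_eq_1_iff)
    qed
    moreover have "h \<noteq> 0" using t assms by (simp add: h_def)
    moreover have "dist h 0 < e"
    proof -
      have "norm h = \<bar>t\<bar> * (2 * norm r)"
        by (simp only: h_def norm_mult norm_of_real norm_numeral)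
      also have "\<dots> = e / 2"
        unfolding abs_of_pos[OF t] using assms by (simp add: t_def norm_mult)
      finally show ?thesis using \<open>e > 0\<close> by simp
    qed
    ultimately show "\<exists>h\<in>{h. \<forall>m>0. qq r h ^ m \<noteq> 1}. h \<noteq> 0 \<and> dist h 0 < e" by blast
  qed
  then show ?thesis by (simp add: ILW_def trivial_limit_within)
qed

lemma power_bigo_power:
  assumes "j \<le> k"
  shows "(\<lambda>h. h ^ k) \<in> O[ILW r](\<lambda>h. h ^ j)"
proof (rule landau_o.bigI[where c = 1])
  have "\<forall>\<^sub>F h in at 0. norm (h :: complex) \<le> 1"
    using eventually_at[of "\<lambda>h. norm h \<le> 1" "0 :: complex" UNIV] by (auto intro!: exI[of _ 1])
  then show "\<forall>\<^sub>F h in ILW r. norm (h ^ k) \<le> 1 * norm (h ^ j)"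
    by (rule filter_leD[OF ILW_le, THEN eventually_mono])
      (use assms in \<open>auto simp: norm_power intro: power_decreasing\<close>)
qed simp

lemma bigo_power_mono:
  assumes "u \<in> O[ILW r](\<lambda>h. h ^ k)" "j \<le> k"
  shows "u \<in> O[ILW r](\<lambda>h. h ^ j)"
  using assms(1) power_bigo_power[OF assms(2)] by (rule landau_o.big_trans)

lemma bigo_power_mult:
  assumes "u \<in> O[ILW r](\<lambda>h. h ^ j)" "w \<in> O[ILW r](\<lambda>h. h ^ k)" "l \<le> j + k"
  shows "(\<lambda>h. u h * w h) \<in> O[ILW r](\<lambda>h. h ^ l)"
proof (rule bigo_power_mono[OF _ assms(3)])
  show "(\<lambda>h. u h * w h) \<in> O[ILW r](\<lambda>h. h ^ (j + k))"
    unfolding power_add by (rule landau_o.big.mult[OF assms(1,2)])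
qed

lemma const_bigo: "(\<lambda>h. c) \<in> O[ILW r](\<lambda>h. h ^ 0)"
  by simp

lemma id_bigo: "(\<lambda>h. c * h) \<in> O[ILW r](\<lambda>h. h ^ 1)"
  using bigo_power_mult[OF const_bigo[of c r] power_bigo_power[of 1 1 r], of 1] by simp

lemma scaled_power_bigo: "(\<lambda>h. (c * h) ^ k) \<in> O[ILW r](\<lambda>h. h ^ k)"
  using landau_o.big_power[OF id_bigo] by simp

text \<open>Most factors below are of the form \<open>1 + O(h\<^sup>k)\<close>. This class is closed under products and, for \<open>k > 0\<close>,
  under inverses, so that estimates of products reduce to those of their factors.\<close>

definition near_one :: "complex \<Rightarrow> nat \<Rightarrow> (complex \<Rightarrow> complex) \<Rightarrow> bool" where
  "near_one r k u \<longleftrightarrow> (\<lambda>h. u h - 1) \<in> O[ILW r](\<lambda>h. h ^ k)"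

lemma near_one_const: "near_one r k (\<lambda>h. 1)"
  by (simp add: near_one_def)

lemma near_one_mono: "near_one r k u \<Longrightarrow> j \<le> k \<Longrightarrow> near_one r j u"
  unfolding near_one_def by (rule bigo_power_mono)

lemma near_one_bounded:
  assumes "near_one r k u"
  shows "u \<in> O[ILW r](\<lambda>h. h ^ 0)"
proof -
  have "(\<lambda>h. (u h - 1) + 1) \<in> O[ILW r](\<lambda>h. h ^ 0)"
    using assms bigo_power_mono[of "\<lambda>h. u h - 1" r k 0]
    by (intro sum_in_bigo(1) const_bigo) (auto simp: near_one_def)
  then show ?thesis by simp
qed

lemma near_one_mult:
  assumes "near_one r k u" "near_one r k w"
  shows "near_one r k (\<lambda>h. u h * w h)"
proof -
  have "(\<lambda>h. (u h - 1) * w h + (w h - 1)) \<in> O[ILW r](\<lambda>h. h ^ k)"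
    using assms near_one_bounded[OF assms(2)]
    by (intro sum_in_bigo(1) bigo_power_mult[of _ _ k _ 0]) (auto simp: near_one_def)
  then show ?thesis by (simp add: near_one_def algebra_simps)
qed

lemma near_one_tendsto:
  assumes "near_one r k u" "k > 0"
  shows "(u \<longlongrightarrow> 1) (ILW r)"
proof -
  have lim: "((\<lambda>h. h ^ k) \<longlongrightarrow> 0) (ILW r)"
  proof (rule tendsto_mono[OF ILW_le])
    have "((\<lambda>h. h ^ k) \<longlongrightarrow> (0 :: complex) ^ k) (at 0)"
      by (intro tendsto_intros)
    then show "((\<lambda>h. h ^ k) \<longlongrightarrow> (0 :: complex)) (at 0)" using assms(2) by (simp add: zero_power)
  qed
  have "(\<lambda>h. h ^ k) \<in> o[ILW r](\<lambda>h. 1)"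
    using lim by (intro smalloI_tendsto) auto
  then have "(\<lambda>h. u h - 1) \<in> o[ILW r](\<lambda>h. 1)"
    using assms(1) unfolding near_one_def by (rule landau_o.big_small_trans[rotated])
  then have "((\<lambda>h. u h - 1) \<longlongrightarrow> 0) (ILW r)"
    by (auto dest: smalloD_tendsto)
  then show ?thesis by (simp add: LIM_zero_iff)
qed

lemma near_one_inverse:
  assumes "near_one r k u" "k > 0"
  shows "near_one r k (\<lambda>h. inverse (u h))"
proof -
  have lim: "(u \<longlongrightarrow> 1) (ILW r)" using near_one_tendsto[OF assms] .
  then have nz: "\<forall>\<^sub>F h in ILW r. u h \<noteq> 0"
    by (rule tendsto_imp_eventually_ne) simp
  have "((\<lambda>h. inverse (u h)) \<longlongrightarrow> inverse 1) (ILW r)"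
    by (intro tendsto_inverse lim) simp
  then have "(\<lambda>h. inverse (u h)) \<in> O[ILW r](\<lambda>h. h ^ 0)"
    by (intro bigoI_tendsto[where c = 1]) simp_all
  then have "(\<lambda>h. (u h - 1) * inverse (u h)) \<in> O[ILW r](\<lambda>h. h ^ k)"
    using assms(1) unfolding near_one_def by (intro bigo_power_mult[of _ _ k _ 0]) simp_all
  then have "(\<lambda>h. - ((u h - 1) * inverse (u h))) \<in> O[ILW r](\<lambda>h. h ^ k)"
    by simp
  moreover have "\<forall>\<^sub>F h in ILW r. - ((u h - 1) * inverse (u h)) = inverse (u h) - 1"
    using nz by eventually_elim (simp add: field_simps)
  ultimately show ?thesis
    unfolding near_one_def by (subst (asm) landau_o.big.in_cong) auto
qed

lemma near_one_cong:
  assumes "near_one r k u" "\<forall>\<^sub>F h in ILW r. u h = w h"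
  shows "near_one r k w"
proof -
  have "\<forall>\<^sub>F h in ILW r. u h - 1 = w h - 1" using assms(2) by eventually_elim simp
  from landau_o.big.in_cong[OF this] assms(1) show ?thesis by (simp add: near_one_def)
qed

lemma near_one_prod_list:
  assumes "\<And>m. m \<in> set ms \<Longrightarrow> near_one r k (u m)"
  shows "near_one r k (\<lambda>h. \<Prod>m\<leftarrow>ms. u m h)"
  using assms by (induction ms) (auto intro: near_one_mult near_one_const)

lemma exp_bigo: "(\<lambda>h. exp (c * h) - (\<Sum>k\<le>n. (c * h) ^ k / fact k)) \<in> O[ILW r](\<lambda>h. h ^ Suc n)"
proof (rule landau_o.big.filter_mono[OF ILW_le], rule landau_o.bigI[where c = "exp (norm c) * norm c ^ Suc n / fact n + 1"])
  show "\<forall>\<^sub>F h in at 0. norm (exp (c * h) - (\<Sum>k\<le>n. (c * h) ^ k / fact k))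
     \<le> (exp (norm c) * norm c ^ Suc n / fact n + 1) * norm (h ^ Suc n)"
  proof -
    have "\<forall>\<^sub>F h in at 0. norm (h :: complex) \<le> 1"
      using eventually_at[of "\<lambda>h. norm h \<le> 1" "0 :: complex" UNIV] by (auto intro!: exI[of _ 1])
    then show ?thesis
    proof eventually_elim
      case (elim h)
      have "norm (exp (c * h) - (\<Sum>k\<le>n. (c * h) ^ k / fact k)) \<le> exp (norm (c * h)) * norm (c * h) ^ Suc n / fact n"
        by (rule Taylor_exp_field)
      also have "\<dots> \<le> exp (norm c) * norm (c * h) ^ Suc n / fact n"
        using elim by (intro divide_right_mono mult_right_mono) (auto simp: norm_mult mult_left_le)
      also have "\<dots> = exp (norm c) * norm c ^ Suc n / fact n * norm (h ^ Suc n)"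
        by (simp add: norm_mult norm_power power_mult_distrib)
      also have "\<dots> \<le> (exp (norm c) * norm c ^ Suc n / fact n + 1) * norm (h ^ Suc n)"
        by (intro mult_right_mono) auto
      finally show ?case .
    qed
  qed
  have "0 \<le> exp (norm c) * norm c ^ Suc n / fact n" by simp
  then show "exp (norm c) * norm c ^ Suc n / fact n + 1 > 0" by linarith
qed

lemma exp_bigo_2: "(\<lambda>h. exp (c * h) - (1 + c * h)) \<in> O[ILW r](\<lambda>h. h ^ 2)"
  using exp_bigo[of c 1 r] by (simp add: numeral_2_eq_2)

lemma exp_bigo_3: "(\<lambda>h. exp (c * h) - (1 + c * h + (c * h)\<^sup>2 / 2)) \<in> O[ILW r](\<lambda>h. h ^ 3)"
  using exp_bigo[of c 2 r] by (simp add: numeral_2_eq_2 numeral_3_eq_3)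

lemma exp_bigo_4: "(\<lambda>h. exp (c * h) - (1 + c * h + (c * h)\<^sup>2 / 2 + (c * h) ^ 3 / 6)) \<in> O[ILW r](\<lambda>h. h ^ 4)"
proof -
  have "{..3::nat} = {0, 1, 2, 3}" by auto
  then show ?thesis using exp_bigo[of c 3 r] by (simp add: fact_numeral algebra_simps)
qed

text \<open>Twice the hyperbolic sine; there is no term of order \<open>h\<^sup>2\<close>.\<close>

lemma sinh_bigo: "(\<lambda>h. exp (c * h) - exp (- (c * h)) - 2 * c * h) \<in> O[ILW r](\<lambda>h. h ^ 3)"
  using sum_in_bigo(2)[OF exp_bigo_3[of c r] exp_bigo_3[of "- c" r]]
  by (simp add: algebra_simps)

text \<open>Twice the hyperbolic cosine; the absence of a term of order \<open>h\<^sup>3\<close> is what keeps the expansion of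
  \<open>T\<^sup>D\<^sup>V\<close> even.\<close>

lemma cosh_bigo: "(\<lambda>h. exp (c * h) + exp (- (c * h)) - (2 + (c * h)\<^sup>2)) \<in> O[ILW r](\<lambda>h. h ^ 4)"
  using sum_in_bigo(1)[OF exp_bigo_4[of c r] exp_bigo_4[of "- c" r]]
  by (simp add: algebra_simps power2_eq_square power3_eq_cube)

lemma near_one_sinh:
  assumes "c \<noteq> 0"
  shows "near_one r 2 (\<lambda>h. (exp (c * h) - exp (- (c * h))) / (2 * c * h))"
proof -
  have "(\<lambda>h. (exp (c * h) - exp (- (c * h)) - 2 * c * h) / (2 * c * h)) \<in> O[ILW r](\<lambda>h. h ^ 3 / (2 * c * h))"
    using sinh_bigo eventually_ILW_nz[of r] assms by (intro landau_o.big.divide_right) (auto elim: eventually_mono)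
  also have "(\<lambda>h. h ^ 3 / (2 * c * h)) \<in> O[ILW r](\<lambda>h. h ^ 2)"
  proof (rule landau_o.bigI[where c = "norm (inverse (2 * c))"])
    show "\<forall>\<^sub>F h in ILW r. norm (h ^ 3 / (2 * c * h)) \<le> norm (inverse (2 * c)) * norm (h ^ 2)"
      using eventually_ILW_nz[of r]
      by eventually_elim
        (simp add: norm_mult norm_divide norm_power norm_inverse power3_eq_cube power2_eq_square field_simps)
  qed (use assms in simp)
  finally have "(\<lambda>h. (exp (c * h) - exp (- (c * h)) - 2 * c * h) / (2 * c * h)) \<in> O[ILW r](\<lambda>h. h ^ 2)" .
  moreover have "\<forall>\<^sub>F h in ILW r. (exp (c * h) - exp (- (c * h)) - 2 * c * h) / (2 * c * h) =
     (exp (c * h) - exp (- (c * h))) / (2 * c * h) - 1"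
    using eventually_ILW_nz[of r] by eventually_elim (use assms in \<open>simp add: divide_simps\<close>)
  ultimately show ?thesis
    unfolding near_one_def by (subst (asm) landau_o.big.in_cong) auto
qed

section \<open>Expansion of the commutators and of the weights of words\<close>

text \<open>Because \<open>q\<^sub>1 q\<^sub>2 q\<^sub>3 = 1\<close>, the product of the three factors \<open>1 - q\<^sub>i\<^sup>m\<close> is up to a constant a product of three
  hyperbolic sines. One of them cancels against \<open>[2m]\<close>, up to a hyperbolic cosine. In this form the bracket is visibly an
  even function of \<open>h\<close>.\<close>

lemma bracket_eq:
  assumes "r \<noteq> 0" "m > 0" "\<forall>m>0. qq r h ^ m \<noteq> 1"
  shows "bracket r h m =
    - (exp ((1 - r) * of_nat m / (2 * r) * h) - exp (- ((1 - r) * of_nat m / (2 * r) * h)))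
      * (exp (of_nat m / 2 * h) - exp (- (of_nat m / 2 * h)))
      / (of_nat m * (exp (of_nat m / (2 * r) * h) + exp (- (of_nat m / (2 * r) * h))))"
proof -
  define A where "A = exp ((1 - r) * of_nat m / (2 * r) * h)"
  define B where "B = exp (of_nat m / (2 * r) * h)"
  define D where "D = exp (of_nat m / 2 * h)"
  define \<delta> where "\<delta> = qq r h - inverse (qq r h)"
  have nz: "A \<noteq> 0" "B \<noteq> 0" "D \<noteq> 0" by (simp_all add: A_def B_def D_def)
  \<comment> \<open>This is \<open>q\<^sub>1 q\<^sub>2 q\<^sub>3 = 1\<close>, as \<open>A\<^sup>2\<close>, \<open>B\<^sup>-\<^sup>2\<close> and \<open>D\<^sup>2\<close> are the powers of \<open>q\<^sub>1\<close>, \<open>q\<^sub>2\<close> and \<open>q\<^sub>3\<close>.\<close>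
  have AD: "A * D = B"
    unfolding A_def B_def D_def exp_add[symmetric] using assms(1) by (simp add: field_simps)
  have Q: "qq r h ^ m = inverse B"
    by (simp add: qq_def xpow_def B_def flip: exp_of_nat_mult exp_minus)
  have q1: "q1 r h ^ m = A\<^sup>2" and q3: "q3 r h ^ m = D\<^sup>2"
    using assms(1)
    by (simp_all add: q1_def q3_def xpow_def A_def D_def field_simps
        flip: exp_of_nat_mult exp_double)
  have "q2 r h = (qq r h)\<^sup>2"
    by (simp add: q2_def qq_def xpow_def flip: exp_double)
  then have "q2 r h ^ m = (qq r h ^ m)\<^sup>2"
    by (simp add: mult.commute flip: power_mult)
  then have q2: "q2 r h ^ m = inverse (B\<^sup>2)"
    by (simp add: Q power_inverse)
  have qm: "qint r h (int m) = (inverse B - B) / \<delta>"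
    using Q by (simp add: qint_def \<delta>_def power_int_minus)
  have "qq r h powi (2 * int m) = (qq r h ^ m)\<^sup>2"
    by (simp add: power_int_def nat_mult_distrib flip: power_mult) (simp add: mult.commute)
  then have q2m: "qint r h (2 * int m) = (inverse (B\<^sup>2) - B\<^sup>2) / \<delta>"
    using Q by (simp add: qint_def \<delta>_def power_int_minus power_inverse)
  have q_nz: "qq r h \<noteq> 0" by (simp add: qq_def xpow_def)
  have "qq r h ^ 2 \<noteq> 1" using assms(3) by simp
  then have \<delta>: "\<delta> \<noteq> 0" using q_nz by (auto simp: \<delta>_def power2_eq_square field_simps)
  have "(qq r h) ^ (4 * m) \<noteq> 1" using assms(2,3) by simp
  moreover have "qq r h ^ (4 * m) = inverse B ^ 4" by (simp add: power_mult[of _ m 4, unfolded mult.commute[of m 4]] Q)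
  ultimately have B4: "B ^ 4 \<noteq> 1" by (auto simp: power_inverse)
  then have B2: "1 - B ^ 4 \<noteq> 0" by simp
  have fac: "1 - B ^ 4 = (1 - B\<^sup>2) * (1 + B\<^sup>2)" by (simp add: algebra_simps power2_eq_square power4_eq_xxxx)
  \<comment> \<open>So \<open>[2m]\<close> does not vanish.\<close>
  have B3: "1 - B\<^sup>2 \<noteq> 0" "1 + B\<^sup>2 \<noteq> 0" using B2 unfolding fac by auto
  have "bracket r h m = (inverse B + B) * ((inverse B - B) / \<delta> / (of_nat m * \<delta>)) * (1 - A\<^sup>2) * (1 - inverse (B\<^sup>2)) * (1 - D\<^sup>2)
     / ((inverse (B\<^sup>2) - B\<^sup>2) / \<delta>)\<^sup>2"
  proof -
    have signs: "- s * (- u * x * y * z) / w = s * u * x * y * z / w" for s u x y z w :: complex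
      by simp
    show ?thesis
      unfolding bracket_def hcomm_def Q q1 q2 q3 qm q2m inverse_inverse_eq \<delta>_def[symmetric] by (rule signs)
  qed
  also have "\<dots> = - (A - inverse A) * (D - inverse D) / (of_nat m * (B + inverse B))"
  proof -
    have b: "inverse B + B = (1 + B\<^sup>2) / B" "inverse B - B = (1 - B\<^sup>2) / B"
      "inverse (B\<^sup>2) - B\<^sup>2 = (1 - B\<^sup>2) * (1 + B\<^sup>2) / B\<^sup>2" "1 - inverse (B\<^sup>2) = - (1 - B\<^sup>2) / B\<^sup>2"
      "B + inverse B = (1 + B\<^sup>2) / B"
      using nz by (simp_all add: field_simps power2_eq_square power4_eq_xxxx)
    have a: "A - inverse A = - (1 - A\<^sup>2) / A" "D - inverse D = - (1 - D\<^sup>2) / D"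
      using nz by (simp_all add: field_simps power2_eq_square)
    define x y z w where "x = 1 - A\<^sup>2" and "y = 1 - B\<^sup>2" and "z = 1 - D\<^sup>2" and "w = 1 + B\<^sup>2"
    have "y \<noteq> 0" "w \<noteq> 0" using B3 by (simp_all add: y_def w_def)
    then show ?thesis
      unfolding a b x_def[symmetric] y_def[symmetric] z_def[symmetric] w_def[symmetric]
      unfolding AD[symmetric] using nz \<delta> assms(2) by (simp add: field_simps power2_eq_square)
  qed
  finally show ?thesis unfolding A_def B_def D_def exp_minus .
qed

lemma near_one_cosh: "near_one r 2 (\<lambda>h. (exp (c * h) + exp (- (c * h))) / 2)"
proof -
  have "(\<lambda>h. (exp (c * h) + exp (- (c * h)) - (2 + (c * h)\<^sup>2)) + (c * h)\<^sup>2) \<in> O[ILW r](\<lambda>h. h ^ 2)"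
    by (intro sum_in_bigo(1) scaled_power_bigo bigo_power_mono[OF cosh_bigo]) simp
  then have "(\<lambda>h. exp (c * h) + exp (- (c * h)) - 2) \<in> O[ILW r](\<lambda>h. h ^ 2)"
    by (simp add: algebra_simps)
  then have "(\<lambda>h. (1 / 2) * (exp (c * h) + exp (- (c * h)) - 2)) \<in> O[ILW r](\<lambda>h. h ^ 2)"
    by (simp only: cmult_in_bigo_iff simp_thms)
  moreover have "(1 / 2) * (exp (c * h) + exp (- (c * h)) - 2) = (exp (c * h) + exp (- (c * h))) / 2 - 1" for h
    by (simp add: field_simps)
  ultimately show ?thesis by (simp only: near_one_def)
qed

lemma near_one_bracket:
  assumes "r \<noteq> 0" "beta r \<noteq> 0" "m > 0"
  shows "near_one r 2 (\<lambda>h. 2 / of_nat m * bracket r h m / (beta r * h\<^sup>2))"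
proof -
  let ?S = "\<lambda>c h. (exp (c * h) - exp (- (c * h)))"
  define c d e where "c = (1 - r) * of_nat m / (2 * r)" and "d = (of_nat m :: complex) / 2"
    and "e = of_nat m / (2 * r)"
  have "r \<noteq> 1" using assms(2) by (auto simp: beta_def)
  then have nz: "c \<noteq> 0" "d \<noteq> 0" using assms by (auto simp: c_def d_def)
  have "near_one r 2 (\<lambda>h. ?S c h / (2 * c * h) * (?S d h / (2 * d * h))
      * inverse ((exp (e * h) + exp (- (e * h))) / 2))"
    by (intro near_one_mult near_one_inverse near_one_sinh near_one_cosh nz) simp
  moreover have "\<forall>\<^sub>F h in ILW r. ?S c h / (2 * c * h) * (?S d h / (2 * d * h))
      * inverse ((exp (e * h) + exp (- (e * h))) / 2) = 2 / of_nat m * bracket r h m / (beta r * h\<^sup>2)"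
    using eventually_ILW_root[of r] eventually_ILW_nz[of r]
  proof eventually_elim
    case (elim h)
    \<comment> \<open>The leading coefficients of the hyperbolic sines produce exactly the normalization \<open>\<beta> h\<^sup>2 m / 2\<close>.\<close>
    have cd: "4 * c * d = - beta r * (of_nat m)\<^sup>2"
      using assms(1) by (simp add: c_def d_def beta_def field_simps power2_eq_square)
    define C where "C = exp (e * h) + exp (- (e * h))"
    have "x / (2 * c * h) * (y / (2 * d * h)) * inverse (C / 2) = 2 * x * y / (4 * c * d * h\<^sup>2 * C)" for x y
      using nz elim(2) by (cases "C = 0") (simp_all add: field_simps power2_eq_square)
    then have "?S c h / (2 * c * h) * (?S d h / (2 * d * h)) * inverse (C / 2) =
       2 * ?S c h * ?S d h / (4 * c * d * h\<^sup>2 * C)" .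
    also have "2 * x * y / (4 * c * d * h\<^sup>2 * C) = 2 / of_nat m * (- x * y / (of_nat m * C)) / (beta r * h\<^sup>2)" for x y
      unfolding cd using assms elim(2) by (cases "C = 0") (simp_all add: field_simps power2_eq_square)
    also have "- ?S c h * ?S d h / (of_nat m * C) = bracket r h m"
      unfolding bracket_eq[OF assms(1,3) elim(1)] C_def c_def d_def e_def ..
    finally show ?case by (simp only: C_def)
  qed
  ultimately show ?thesis by (rule near_one_cong)
qed

definition osc_ratio :: "complex \<Rightarrow> (nat \<Rightarrow> complex \<Rightarrow> complex) \<Rightarrow> complex \<Rightarrow> int \<Rightarrow> complex" where
  "osc_ratio r f h n = osc_scale r f h n / unit_scale r h"

lemma unit_scale_square: "unit_scale r h * unit_scale r h = beta r * h\<^sup>2"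
proof -
  have "csqrt (beta r) * csqrt (beta r) = beta r"
    using power2_csqrt[of "beta r"] by (simp add: power2_eq_square)
  then show ?thesis unfolding unit_scale_def power2_eq_square by (metis mult.assoc mult.left_commute)
qed

text \<open>There is no correction of first order in \<open>h\<close>: the bracket is even and the prescribed scalings deviate
  from \<open>1\<close> only at second order.\<close>

lemma near_one_osc_ratio:
  assumes "r \<noteq> 0" "beta r \<noteq> 0" "admissible_scaling r f" "n \<noteq> 0"
  shows "near_one r 2 (\<lambda>h. osc_ratio r f h n)"
proof -
  have f: "near_one r 2 (f m)" if "m > 0" for m
    using assms(3) that by (simp add: admissible_scaling_def near_one_def)
  show ?thesis
  proof (cases "n < 0")
    case True
    have "\<forall>\<^sub>F h in ILW r. f (nat (- n)) h = osc_ratio r f h n"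
      using eventually_ILW_nz[of r]
      by eventually_elim (use True assms(2) in \<open>simp add: osc_ratio_def osc_scale_def unit_scale_def\<close>)
    with f[of "nat (- n)"] True show ?thesis by (auto intro: near_one_cong)
  next
    case False
    then have n: "nat n > 0" using assms(4) by simp
    have eq: "osc_ratio r f h n = 2 / of_nat (nat n) * bracket r h (nat n) / (beta r * h\<^sup>2) * inverse (f (nat n) h)" for h
      using False by (simp add: osc_ratio_def osc_scale_def divide_inverse inverse_mult_distrib mult_ac
          flip: unit_scale_square)
    show ?thesis unfolding eq
      by (intro near_one_mult near_one_bracket near_one_inverse f assms n) simp
  qed
qed

lemma osc_scale_pair:
  assumes "m > 0" "f m h \<noteq> 0" "unit_scale r h \<noteq> 0"
  shows "osc_scale r f h (- int m) * osc_scale r f h (int m) = 2 / of_nat m * bracket r h m"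
  using assms by (simp add: osc_scale_def)

text \<open>The only source of an odd correction, and of the hyperbolic cotangent: with \<open>p\<^sup>m = e\<^sup>2\<^sup>m\<^sup>\<tau>\<close> the linear
  coefficient contains \<open>(1 + p\<^sup>m) / (1 - p\<^sup>m) = - coth (m \<tau>)\<close>.\<close>

lemma dressing_expansion:
  assumes "r \<noteq> 0" "pp \<tau> ^ m \<noteq> 1" "m > 0"
  shows "(\<lambda>h. dressing r \<tau> h (int m) - (1 - of_nat m * coth (of_nat m * \<tau>) * h / r)) \<in> O[ILW r](\<lambda>h. h ^ 2)"
proof -
  define P where "P = pp \<tau> ^ m"
  define c where "c = of_nat m / r"
  have P: "1 - P \<noteq> 0" using assms(2) by (simp add: P_def)
  have E: "qq r h powi (- 2 * int m) = exp (c * h)" "qq r h powi (2 * int m) = exp (- c * h)" for h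
  proof -
    have *: "qq r h powi (2 * int m) = exp (- c * h)"
      using assms(1) by (simp add: power_int_def nat_mult_distrib qq_def xpow_def c_def field_simps flip: exp_of_nat_mult)
    then show "qq r h powi (2 * int m) = exp (- c * h)" .
    show "qq r h powi (- 2 * int m) = exp (c * h)"
      using * by (simp add: power_int_minus exp_minus)
  qed
  have coth: "coth (of_nat m * \<tau>) = - (1 + P) / (1 - P)"
  proof -
    define x where "x = exp (of_nat m * \<tau>)"
    have "x \<noteq> 0" by (simp add: x_def)
    have P': "P = x * x"
      by (simp add: P_def pp_def x_def algebra_simps flip: exp_of_nat_mult exp_add)
    have x: "x * x - 1 \<noteq> 0" using P by (auto simp: P')
    have half: "(X / 2) / (Y / 2) = X / Y" for X Y :: complex by simp
    have "coth (of_nat m * \<tau>) = (x + inverse x) / (x - inverse x)"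
      unfolding coth_def cosh_field_def sinh_field_def x_def exp_minus by (rule half)
    also have "\<dots> = (x * (x + inverse x)) / (x * (x - inverse x))"
      using \<open>x \<noteq> 0\<close> by simp
    also have "\<dots> = (x * x + 1) / (x * x - 1)"
      using \<open>x \<noteq> 0\<close> by (simp add: algebra_simps)
    also have "\<dots> = - (1 + P) / (1 - P)"
      using x P by (simp add: P' field_simps)
    finally show ?thesis .
  qed
  have "(\<lambda>h. (exp (c * h) - (1 + c * h)) - P * (exp (- c * h) - (1 + - c * h))) \<in> O[ILW r](\<lambda>h. h ^ 2)"
    by (intro sum_in_bigo(2) exp_bigo_2) (cases "P = 0", auto intro!: exp_bigo_2[of "- c", simplified])
  then have "(\<lambda>h. inverse (1 - P) * ((exp (c * h) - (1 + c * h)) - P * (exp (- c * h) - (1 + - c * h)))) \<in> O[ILW r](\<lambda>h. h ^ 2)"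
    using P by simp
  moreover have "inverse (1 - P) * ((exp (c * h) - (1 + c * h)) - P * (exp (- c * h) - (1 + - c * h)))
    = dressing r \<tau> h (int m) - (1 - of_nat m * coth (of_nat m * \<tau>) * h / r)" for h
  proof -
    have "dressing r \<tau> h (int m) = (exp (c * h) - P * exp (- c * h)) / (1 - P)"
      using E by (simp add: dressing_def P_def)
    moreover define K where "K = of_nat m * coth (of_nat m * \<tau>) * h / r"
    moreover have "K = (- (c * h) - P * (c * h)) / (1 - P)"
      unfolding K_def coth using P assms(1) by (simp add: c_def field_simps)
    ultimately show ?thesis using P unfolding K_def[symmetric] by (simp add: field_simps)
  qed
  ultimately show ?thesis by (simp only:)
qed

lemma near_one_dressing:
  assumes "r \<noteq> 0" "\<forall>m>0. pp \<tau> ^ m \<noteq> 1" "n \<noteq> 0"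
  shows "near_one r 1 (\<lambda>h. dressing r \<tau> h n)"
proof (cases "n < 0")
  case True
  then show ?thesis by (simp add: dressing_def near_one_const)
next
  case False
  define m where "m = nat n"
  have m: "m > 0" "n = int m" using False assms(3) by (simp_all add: m_def)
  define c where "c = - of_nat m * coth (of_nat m * \<tau>) / r"
  have "(\<lambda>h. dressing r \<tau> h (int m) - (1 + c * h)) \<in> O[ILW r](\<lambda>h. h ^ 2)"
    using dressing_expansion[of r \<tau> m] assms m by (simp add: c_def)
  then have "(\<lambda>h. (dressing r \<tau> h (int m) - (1 + c * h)) + c * h) \<in> O[ILW r](\<lambda>h. h ^ 1)"
    by (intro sum_in_bigo(1) id_bigo) (erule bigo_power_mono, simp)
  then show ?thesis by (simp add: near_one_def m(2))
qed

lemma word_weight_scale: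
  "word_weight (\<lambda>m. c * \<phi> m) ms ls = c ^ (length ms + length ls) * word_weight \<phi> ms ls"
proof -
  have "(\<Prod>m\<leftarrow>ms. c * \<psi> m) = c ^ length ms * (\<Prod>m\<leftarrow>ms. \<psi> m)" for ms :: "nat list" and \<psi>
    by (induction ms) (simp_all add: mult_ac)
  then show ?thesis by (simp add: word_weight_def power_add mult_ac)
qed

text \<open>A factor that is exponential in the mode contributes to a word only through its total mode.\<close>

lemma word_weight_exp:
  "word_weight (\<lambda>m. exp (of_int m * c) * \<phi> m) ms ls =
     exp ((of_nat (sum_list ls) - of_nat (sum_list ms)) * c) * word_weight \<phi> ms ls"
proof -
  have pos: "(\<Prod>m\<leftarrow>ls. exp (of_int (int m) * c) * \<psi> m) = exp (of_nat (sum_list ls) * c) * (\<Prod>m\<leftarrow>ls. \<psi> m)"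
    for ls :: "nat list" and \<psi> and c :: complex
    by (induction ls) (simp_all add: exp_add algebra_simps)
  have neg: "(\<Prod>m\<leftarrow>ms. exp (of_int (- int m) * c) * \<psi> m) = exp (- of_nat (sum_list ms) * c) * (\<Prod>m\<leftarrow>ms. \<psi> m)"
    for ms :: "nat list" and \<psi> and c :: complex
    using pos[of "- c" \<psi> ms] by simp
  show ?thesis
    unfolding word_weight_def pos neg by (simp add: exp_add left_diff_distrib exp_diff exp_minus field_simps)
qed

lemma word_weight_near_one:
  assumes "\<And>m. m \<noteq> 0 \<Longrightarrow> near_one r k (\<lambda>h. \<phi> h m)" "0 \<notin> set ms" "0 \<notin> set ls"
  shows "(\<lambda>h. word_weight (\<phi> h) ms ls - 1 / (fact (length ms) * fact (length ls))) \<in> O[ILW r](\<lambda>h. h ^ k)"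
proof -
  define c where "c = 1 / (fact (length ms) * fact (length ls) :: complex)"
  have "near_one r k (\<lambda>h. (\<Prod>m\<leftarrow>ms. \<phi> h (- int m)) * (\<Prod>m\<leftarrow>ls. \<phi> h (int m)))"
    by (intro near_one_mult near_one_prod_list assms) (use assms(2,3) in \<open>auto intro!: gr0I\<close>)
  then have "(\<lambda>h. c * ((\<Prod>m\<leftarrow>ms. \<phi> h (- int m)) * (\<Prod>m\<leftarrow>ls. \<phi> h (int m)) - 1)) \<in> O[ILW r](\<lambda>h. h ^ k)"
    by (simp add: near_one_def)
  then show ?thesis by (simp add: word_weight_def c_def algebra_simps)
qed

section \<open>Expansion of the coefficients of the two currents\<close>

lemma bigo_eventually_eq:
  fixes u w :: "complex \<Rightarrow> complex"
  assumes "w \<in> O[F](e)" "\<forall>\<^sub>F h in F. u h = w h"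
  shows "u \<in> O[F](e)"
  using landau_o.big.in_cong[OF assms(2)] assms(1) by blast

abbreviation osc_norm :: "nat \<Rightarrow> complex" where
  "osc_norm \<equiv> \<lambda>m. of_nat m / 2"

definition Z_weight where
  "Z_weight r \<tau> f h = word_weight (\<lambda>m. dressing r \<tau> h m * osc_scale r f h m)"

definition TDV_weight where
  "TDV_weight r \<pi> g h ms ls =
     xpow r h \<pi> * word_weight (\<lambda>m. qq r h powi (- m) * osc_scale r g h m) ms ls
   + xpow r h (- \<pi>) * word_weight (\<lambda>m. - (qq r h powi m * osc_scale r g h m)) ms ls"

lemma osc_DeltaZ_eq:
  assumes "deg_le Diag d v"
  shows "osc_DeltaZ r \<tau> f h n v =
    (\<Sum>(ms, ls)\<in>words d n. scal (Z_weight r \<tau> f h ms ls) (word osc_norm Diag ms ls v))"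
  unfolding osc_DeltaZ_def a_def Z_weight_def by (rule nexp_mode_eq[OF assms])

lemma osc_TDV_eq:
  assumes "deg_le Bar d v"
  shows "osc_TDV r \<pi> g h n v =
    (\<Sum>(ms, ls)\<in>words d n. scal (TDV_weight r \<pi> g h ms ls) (word osc_norm Bar ms ls v))"
  unfolding osc_TDV_def b_def nexp_mode_eq[OF assms]
  by (simp add: TDV_weight_def scal_add_left sum.distrib scal_sum_right case_prod_unfold)

text \<open>The coefficient of \<open>\<beta> h\<^sup>2\<close> that a word of mode \<open>n\<close> has in \<open>T\<^sup>D\<^sup>V\<close>. The words of length \<open>0\<close>, \<open>1\<close> and \<open>2\<close> give
  the constant, the linear part (zero mode and background charge) and the quadratic part of a Virasoro
  generator in the free field realization.\<close>

definition Virasoro_weight :: "complex \<Rightarrow> complex \<Rightarrow> int \<Rightarrow> nat list \<Rightarrow> nat list \<Rightarrow> complex" where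
  "Virasoro_weight r \<pi> n ms ls = (let N = length ms + length ls; c = (\<pi> + of_int n) / (2 * r) in
     (if N = 0 then c\<^sup>2 / beta r else if N = 1 then 2 * c / csqrt (beta r) else if N = 2 then 2 else 0)
       / (fact (length ms) * fact (length ls)))"

lemma unit_scale_power_bigo:
  assumes "j \<le> k"
  shows "(\<lambda>h. unit_scale r h ^ k) \<in> O[ILW r](\<lambda>h. h ^ j)"
  unfolding unit_scale_def by (rule bigo_power_mono[OF scaled_power_bigo assms])

text \<open>Both exponentials give a word of length \<open>N\<close> the same weight up to the sign \<open>(-1)\<^sup>N\<close> and the factors
  \<open>x\<^sup>\<pi> q\<^sup>-\<^sup>n\<close> and its inverse, because the powers of \<open>q\<close> add up to the total mode. So the sum is a hyperbolic cosine
  for even \<open>N\<close> and a hyperbolic sine for odd \<open>N\<close>.\<close>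

lemma TDV_weight_eq:
  assumes "(ms, ls) \<in> words d n" "unit_scale r h \<noteq> 0"
  shows "TDV_weight r \<pi> g h ms ls =
    (let N = length ms + length ls; c = (\<pi> + of_int n) / (2 * r) in
      (exp (c * h) + (- 1) ^ N * exp (- (c * h))) * unit_scale r h ^ N * word_weight (osc_ratio r g h) ms ls)"
proof -
  define e where "e = h / (2 * r)"
  have n: "of_nat (sum_list ls) - of_nat (sum_list ms) = (of_int n :: complex)"
    using assms(1) unfolding words_def by (metis (mono_tags, lifting) case_prod_conv mem_Collect_eq of_int_diff of_int_of_nat_eq)
  have scale: "word_weight (osc_scale r g h) ms ls =
      unit_scale r h ^ (length ms + length ls) * word_weight (osc_ratio r g h) ms ls"
    using word_weight_scale[of "unit_scale r h" "osc_ratio r g h" ms ls] assms(2)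
    by (simp add: osc_ratio_def)
  have "qq r h powi (- m) = exp (of_int m * e)" "qq r h powi m = exp (of_int m * (- e))" for m
    by (simp_all add: qq_def xpow_def e_def exp_power_int)
  then have "word_weight (\<lambda>m. qq r h powi (- m) * osc_scale r g h m) ms ls =
      exp (of_int n * e) * word_weight (osc_scale r g h) ms ls"
    "word_weight (\<lambda>m. - (qq r h powi m * osc_scale r g h m)) ms ls =
      exp (of_int n * (- e)) * ((- 1) ^ (length ms + length ls) * word_weight (osc_scale r g h) ms ls)"
    using word_weight_exp[of e "osc_scale r g h" ms ls] word_weight_exp[of "- e" "osc_scale r g h" ms ls]
      word_weight_scale[of "- 1" "\<lambda>m. exp (of_int m * (- e)) * osc_scale r g h m" ms ls]
    by (simp_all add: n)
  moreover have "xpow r h \<pi> * exp (of_int n * e) = exp ((\<pi> + of_int n) / (2 * r) * h)"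
    "xpow r h (- \<pi>) * exp (of_int n * (- e)) = exp (- ((\<pi> + of_int n) / (2 * r) * h))"
    unfolding xpow_def exp_add[symmetric] by (simp_all add: e_def add_divide_distrib algebra_simps)
  ultimately show ?thesis
    unfolding TDV_weight_def Let_def scale
    by (simp only: mult.assoc[symmetric] distrib_right mult.commute[of "(- 1) ^ (length ms + length ls)"
        "exp (- ((\<pi> + of_int n) / (2 * r) * h))"])
qed

text \<open>A word of length \<open>N\<close> carries \<open>h\<^sup>N\<close>, and for odd \<open>N\<close> the hyperbolic sine supplies one more power. Therefore
  only \<open>N \<le> 2\<close> contributes below order \<open>h\<^sup>4\<close>, and the parity of the two hyperbolic functions excludes
  the orders \<open>h\<close> and \<open>h\<^sup>3\<close>.\<close>

lemma TDV_weight_expansion: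
  assumes "r \<noteq> 0" "beta r \<noteq> 0" "admissible_scaling r g" "(ms, ls) \<in> words d n"
  shows "(\<lambda>h. TDV_weight r \<pi> g h ms ls - ((if ms = [] \<and> ls = [] then 2 else 0)
      + beta r * h\<^sup>2 * Virasoro_weight r \<pi> n ms ls)) \<in> O[ILW r](\<lambda>h. h ^ 4)"
proof -
  define N where "N = length ms + length ls"
  define c where "c = (\<pi> + of_int n) / (2 * r)"
  define F :: complex where "F = fact (length ms) * fact (length ls)"
  have F: "F \<noteq> 0" by (simp add: F_def)
  let ?s = "unit_scale r"
  let ?W = "\<lambda>h. word_weight (osc_ratio r g h) ms ls"
  let ?C = "\<lambda>h. exp (c * h) + exp (- (c * h))"
  let ?S = "\<lambda>h. exp (c * h) - exp (- (c * h))"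
  have W: "(\<lambda>h. ?W h - 1 / F) \<in> O[ILW r](\<lambda>h. h ^ 2)"
    unfolding F_def
    by (rule word_weight_near_one)
      (use assms near_one_osc_ratio in \<open>auto simp: words_def\<close>)
  have W0: "?W \<in> O[ILW r](\<lambda>h. h ^ 0)"
  proof -
    have "(\<lambda>h. (?W h - 1 / F) + 1 / F) \<in> O[ILW r](\<lambda>h. h ^ 0)"
      by (intro sum_in_bigo(1) bigo_power_mono[OF W] const_bigo) simp
    then show ?thesis by simp
  qed
  have C: "(\<lambda>h. ?C h - 2) \<in> O[ILW r](\<lambda>h. h ^ 2)"
  proof -
    have "(\<lambda>h. (?C h - (2 + (c * h)\<^sup>2)) + (c * h)\<^sup>2) \<in> O[ILW r](\<lambda>h. h ^ 2)"
      by (intro sum_in_bigo(1) scaled_power_bigo bigo_power_mono[OF cosh_bigo]) simp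
    then show ?thesis by (simp add: algebra_simps)
  qed
  have S: "(\<lambda>h. ?S h) \<in> O[ILW r](\<lambda>h. h ^ 1)"
  proof -
    have "(\<lambda>h. (?S h - 2 * c * h) + (2 * c) * h) \<in> O[ILW r](\<lambda>h. h ^ 1)"
      by (intro sum_in_bigo(1) id_bigo bigo_power_mono[OF sinh_bigo]) simp
    then show ?thesis by (simp add: algebra_simps)
  qed
  have CS: "(\<lambda>h. exp (c * h) + (- 1) ^ N * exp (- (c * h))) \<in> O[ILW r](\<lambda>h. h ^ 0)"
  proof (cases "even N")
    case True
    have "(\<lambda>h. (?C h - 2) + 2) \<in> O[ILW r](\<lambda>h. h ^ 0)"
      by (intro sum_in_bigo(1) bigo_power_mono[OF C] const_bigo) simp
    then show ?thesis using True by simp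
  next
    case False
    then show ?thesis using bigo_power_mono[OF S, of 0] by simp
  qed
  have sqrt: "csqrt (beta r) \<noteq> 0" using assms(2) by simp
  have goal: "(\<lambda>h. (exp (c * h) + (- 1) ^ N * exp (- (c * h))) * ?s h ^ N * ?W h
     - ((if ms = [] \<and> ls = [] then 2 else 0) + beta r * h\<^sup>2 * Virasoro_weight r \<pi> n ms ls)) \<in> O[ILW r](\<lambda>h. h ^ 4)"
  proof -
    consider "N = 0" | "N = 1" | "N = 2" | "N = 3" | "N \<ge> 4" by linarith
    then show ?thesis
    proof cases
      case 1
      then have nil: "ms = []" "ls = []" by (simp_all add: N_def)
      then have "Virasoro_weight r \<pi> n ms ls = c\<^sup>2 / beta r"
        by (simp add: Virasoro_weight_def c_def Let_def)
      then show ?thesis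
        using cosh_bigo[of c r] assms(2) by (simp add: nil 1 word_weight_def power_mult_distrib mult_ac)
    next
      case 2
      then have nn: "\<not> (ms = [] \<and> ls = [])" and F1: "F = 1"
        by (auto simp: N_def F_def add_is_1)
      have V: "beta r * h\<^sup>2 * Virasoro_weight r \<pi> n ms ls = ?s h * (2 * c * h)" for h
      proof -
        have "Virasoro_weight r \<pi> n ms ls = 2 * c / csqrt (beta r)"
          using 2 F1 by (simp add: Virasoro_weight_def c_def N_def F_def Let_def)
        then show ?thesis
          unfolding unit_scale_square[symmetric] using sqrt by (simp add: unit_scale_def)
      qed
      have "(\<lambda>h. ?s h ^ 1 * ((?S h - 2 * c * h) + ?S h * (?W h - 1 / F))) \<in> O[ILW r](\<lambda>h. h ^ 4)"
      proof (rule bigo_power_mult[of _ r 1 _ 3 4, OF unit_scale_power_bigo])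
        show "(\<lambda>h. ?S h - 2 * c * h + ?S h * (?W h - 1 / F)) \<in> O[ILW r](\<lambda>h. h ^ 3)"
          by (intro sum_in_bigo(1) sinh_bigo bigo_power_mult[OF S W]) simp
      qed simp_all
      moreover have "?s h ^ 1 * ((?S h - 2 * c * h) + ?S h * (?W h - 1 / F)) =
          (exp (c * h) + (- 1) ^ N * exp (- (c * h))) * ?s h ^ N * ?W h
           - ((if ms = [] \<and> ls = [] then 2 else 0) + beta r * h\<^sup>2 * Virasoro_weight r \<pi> n ms ls)" for h
        unfolding V 2 F1 if_not_P[OF nn] by (simp add: algebra_simps)
      ultimately show ?thesis by (simp only:)
    next
      case 3
      then have nn: "\<not> (ms = [] \<and> ls = [])" by (auto simp: N_def)
      have "Virasoro_weight r \<pi> n ms ls = 2 / F"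
        using 3 by (simp add: Virasoro_weight_def N_def F_def Let_def)
      moreover have "(\<lambda>h. ?s h ^ 2 * ((?C h - 2) * ?W h + 2 * (?W h - 1 / F))) \<in> O[ILW r](\<lambda>h. h ^ 4)"
      proof (rule bigo_power_mult[of _ r 2 _ 2 4, OF unit_scale_power_bigo])
        show "(\<lambda>h. (?C h - 2) * ?W h + 2 * (?W h - 1 / F)) \<in> O[ILW r](\<lambda>h. h ^ 2)"
          by (intro sum_in_bigo(1) bigo_power_mult[OF C W0] bigo_power_mult[OF const_bigo W]) simp_all
      qed simp_all
      moreover have "?s h ^ 2 * ((?C h - 2) * ?W h + 2 * (?W h - 1 / F)) =
          ?C h * ?s h ^ 2 * ?W h - beta r * h\<^sup>2 * (2 / F)" for h
        unfolding unit_scale_square[symmetric] by (simp add: algebra_simps power2_eq_square)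
      ultimately show ?thesis using 3 by (simp add: if_not_P[OF nn])
    next
      case 4
      then have nn: "\<not> (ms = [] \<and> ls = [])" by (auto simp: N_def)
      have "Virasoro_weight r \<pi> n ms ls = 0"
        using 4 by (simp add: Virasoro_weight_def N_def Let_def)
      moreover have "(\<lambda>h. (?S h * ?s h ^ 3) * ?W h) \<in> O[ILW r](\<lambda>h. h ^ 4)"
        by (rule bigo_power_mult[OF bigo_power_mult[OF S unit_scale_power_bigo[of 3 3]] W0, of 4]) simp_all
      ultimately show ?thesis using 4 by (simp add: if_not_P[OF nn])
    next
      case 5
      then have nn: "\<not> (ms = [] \<and> ls = [])" by (auto simp: N_def)
      have "Virasoro_weight r \<pi> n ms ls = 0"
        using 5 by (auto simp: Virasoro_weight_def N_def Let_def)
      moreover have "(\<lambda>h. (exp (c * h) + (- 1) ^ N * exp (- (c * h))) * ?s h ^ N * ?W h) \<in> O[ILW r](\<lambda>h. h ^ 4)"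
        by (rule bigo_power_mult[OF bigo_power_mult[OF CS unit_scale_power_bigo[of 4 N]] W0, of 4]) (use 5 in simp_all)
      ultimately show ?thesis by (simp add: if_not_P[OF nn])
    qed
  qed
  have "\<forall>\<^sub>F h in ILW r. TDV_weight r \<pi> g h ms ls = (exp (c * h) + (- 1) ^ N * exp (- (c * h))) * ?s h ^ N * ?W h"
    using eventually_ILW_nz[of r]
  proof eventually_elim
    case (elim h)
    then have "?s h \<noteq> 0" using sqrt by (simp add: unit_scale_def)
    from TDV_weight_eq[OF assms(4) this] show ?case by (simp only: Let_def N_def c_def)
  qed
  then have "\<forall>\<^sub>F h in ILW r. TDV_weight r \<pi> g h ms ls - ((if ms = [] \<and> ls = [] then 2 else 0)
      + beta r * h\<^sup>2 * Virasoro_weight r \<pi> n ms ls) =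
     (exp (c * h) + (- 1) ^ N * exp (- (c * h))) * ?s h ^ N * ?W h
     - ((if ms = [] \<and> ls = [] then 2 else 0) + beta r * h\<^sup>2 * Virasoro_weight r \<pi> n ms ls)"
    by eventually_elim (simp only:)
  with goal show ?thesis by (rule bigo_eventually_eq)
qed

text \<open>The coefficient of a word in \<open>\<Delta>Z(z)\<close> up to \<open>O(h\<^sup>2)\<close>. This is the accuracy needed against the part of
  \<open>T\<^sup>D\<^sup>V\<close> of order \<open>h\<^sup>2\<close>.\<close>

definition Z_linear :: "complex \<Rightarrow> complex \<Rightarrow> nat list \<Rightarrow> nat list \<Rightarrow> complex" where
  "Z_linear r h ms ls =
     (if ms = [] \<and> ls = [] then 1 else if length ms + length ls = 1 then unit_scale r h else 0)"

text \<open>The coefficient of a word in the constant term of \<open>\<Delta>Z(z)\<close> up to \<open>O(h\<^sup>4)\<close>. This is the accuracy needed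
  against the leading term \<open>2\<close> of \<open>T\<^sup>D\<^sup>V\<close>. Words of length \<open>1\<close> have nonzero mode and do not occur. A word of
  length \<open>3\<close> and total mode \<open>0\<close> has one factor on one side and two on the other, whence the
  denominator \<open>2\<close>.\<close>

definition Z_cubic :: "complex \<Rightarrow> complex \<Rightarrow> complex \<Rightarrow> nat list \<Rightarrow> nat list \<Rightarrow> complex" where
  "Z_cubic r \<tau> h ms ls =
     (if ms = [] \<and> ls = [] then 1
      else if length ms + length ls = 2
        then beta r * h\<^sup>2 * (1 - of_nat (hd ls) * coth (of_nat (hd ls) * \<tau>) * h / r)
      else if length ms + length ls = 3 then unit_scale r h ^ 3 / 2 else 0)"

lemma balanced_word_of_length_2:
  assumes "(ms, ls) \<in> words d 0" "length ms + length ls = 2"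
  obtains m where "m > 0" "ms = [m]" "ls = [m]"
proof -
  have len: "length ms = 0 \<and> length ls = 2 \<or> length ms = 1 \<and> length ls = 1 \<or> length ms = 2 \<and> length ls = 0"
    using assms(2) by linarith
  show ?thesis
    using len assms(1) that
    by (auto simp: words_def length_Suc_conv numeral_2_eq_2)
qed

context
  fixes r \<tau> :: complex and f :: "nat \<Rightarrow> complex \<Rightarrow> complex"
  assumes params: "r \<noteq> 0" "beta r \<noteq> 0" "\<forall>m>0. pp \<tau> ^ m \<noteq> 1" "admissible_scaling r f"
begin

lemma Z_weight_eq:
  assumes "h \<noteq> 0"
  shows "Z_weight r \<tau> f h ms ls = unit_scale r h ^ (length ms + length ls)
     * word_weight (\<lambda>m. dressing r \<tau> h m * osc_ratio r f h m) ms ls"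
proof -
  have "unit_scale r h \<noteq> 0" using assms params(2) by (simp add: unit_scale_def)
  then show ?thesis
    unfolding Z_weight_def word_weight_scale[symmetric] by (simp add: osc_ratio_def mult_ac)
qed

lemma near_one_Z: "m \<noteq> 0 \<Longrightarrow> near_one r 1 (\<lambda>h. dressing r \<tau> h m * osc_ratio r f h m)"
  using near_one_mono[OF near_one_osc_ratio[OF params(1,2,4)], of m 1] params(1,3)
  by (intro near_one_mult near_one_dressing) auto

lemma Z_weight_approx:
  assumes "0 \<notin> set ms" "0 \<notin> set ls" "N = length ms + length ls"
  shows "(\<lambda>h. Z_weight r \<tau> f h ms ls - unit_scale r h ^ N / (fact (length ms) * fact (length ls)))
    \<in> O[ILW r](\<lambda>h. h ^ Suc N)"
proof -
  let ?W = "\<lambda>h. word_weight (\<lambda>m. dressing r \<tau> h m * osc_ratio r f h m) ms ls"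
  let ?F = "fact (length ms) * fact (length ls) :: complex"
  have "(\<lambda>h. unit_scale r h ^ N * (?W h - 1 / ?F)) \<in> O[ILW r](\<lambda>h. h ^ Suc N)"
    by (rule bigo_power_mult[OF unit_scale_power_bigo[OF order.refl] word_weight_near_one[OF near_one_Z]])
      (use assms in simp_all)
  moreover have "\<forall>\<^sub>F h in ILW r. Z_weight r \<tau> f h ms ls - unit_scale r h ^ N / ?F = unit_scale r h ^ N * (?W h - 1 / ?F)"
    using eventually_ILW_nz[of r] by eventually_elim (simp add: Z_weight_eq assms(3) right_diff_distrib)
  ultimately show ?thesis by (rule bigo_eventually_eq)
qed

lemma Z_weight_bigo:
  assumes "0 \<notin> set ms" "0 \<notin> set ls" "j \<le> length ms + length ls"
  shows "(\<lambda>h. Z_weight r \<tau> f h ms ls) \<in> O[ILW r](\<lambda>h. h ^ j)"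
proof -
  let ?N = "length ms + length ls"
  have "(\<lambda>h. (Z_weight r \<tau> f h ms ls - unit_scale r h ^ ?N / (fact (length ms) * fact (length ls)))
     + 1 / (fact (length ms) * fact (length ls)) * unit_scale r h ^ ?N) \<in> O[ILW r](\<lambda>h. h ^ j)"
    by (intro sum_in_bigo(1) bigo_power_mono[OF Z_weight_approx[OF assms(1,2) refl]]
        bigo_power_mult[OF const_bigo unit_scale_power_bigo[OF assms(3)]])
      (use assms(3) in simp_all)
  then show ?thesis by simp
qed

lemma Z_weight_linear:
  assumes "(ms, ls) \<in> words d n"
  shows "(\<lambda>h. Z_weight r \<tau> f h ms ls - Z_linear r h ms ls) \<in> O[ILW r](\<lambda>h. h ^ 2)"
proof -
  have nz: "0 \<notin> set ms" "0 \<notin> set ls" using assms by (auto simp: words_def)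
  consider "ms = []" "ls = []" | "length ms + length ls = 1" | "length ms + length ls \<ge> 2"
  proof -
    have "length ms + length ls = 0 \<or> length ms + length ls = 1 \<or> length ms + length ls \<ge> 2"
      by linarith
    then show ?thesis using that by auto
  qed
  then show ?thesis
  proof cases
    case 1
    then show ?thesis by (simp add: Z_linear_def Z_weight_def word_weight_def)
  next
    case 2
    then have "fact (length ms) * fact (length ls) = (1 :: complex)" "\<not> (ms = [] \<and> ls = [])"
      by (auto simp: add_is_1)
    moreover have "Z_linear r h ms ls = unit_scale r h" for h
      using 2 by (auto simp: Z_linear_def)
    ultimately show ?thesis
      using Z_weight_approx[OF nz 2[symmetric]] by (simp add: numeral_2_eq_2)
  next
    case 3
    then have "Z_linear r h ms ls = 0" for h by (auto simp: Z_linear_def)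
    then show ?thesis using Z_weight_bigo[OF nz 3] by simp
  qed
qed

text \<open>For words of length \<open>2\<close>, of the form \<open>a\<^sub>-\<^sub>m a\<^sub>m\<close>, the leading approximation is not sufficient and the linear term
  of the dressing enters. The scaling \<open>f\<close> drops out of these words entirely, since it occurs in the two
  factors with inverse powers.\<close>

lemma Z_weight_cubic:
  assumes "(ms, ls) \<in> words d 0"
  shows "(\<lambda>h. Z_weight r \<tau> f h ms ls - Z_cubic r \<tau> h ms ls) \<in> O[ILW r](\<lambda>h. h ^ 4)"
proof -
  have nz: "0 \<notin> set ms" "0 \<notin> set ls" and bal: "sum_list ms = sum_list ls"
    using assms by (auto simp: words_def)
  have "length ms + length ls \<noteq> 1"
    using nz bal by (auto simp: add_is_1 length_Suc_conv)
  consider "ms = []" "ls = []" | "length ms + length ls = 2" | "length ms + length ls = 3" | "length ms + length ls \<ge> 4"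
  proof -
    have "length ms + length ls = 0 \<or> length ms + length ls = 2 \<or> length ms + length ls = 3 \<or> length ms + length ls \<ge> 4"
      using \<open>length ms + length ls \<noteq> 1\<close> by linarith
    then show ?thesis using that by auto
  qed
  then show ?thesis
  proof cases
    case 1
    then show ?thesis by (simp add: Z_cubic_def Z_weight_def word_weight_def)
  next
    case 2
    then obtain m where m: "m > 0" "ms = [m]" "ls = [m]" using balanced_word_of_length_2[OF assms] by metis
    let ?A = "\<lambda>h. 2 / of_nat m * bracket r h m / (beta r * h\<^sup>2)"
    let ?D = "\<lambda>h. dressing r \<tau> h (int m)"
    let ?E = "\<lambda>h. 1 - of_nat m * coth (of_nat m * \<tau>) * h / r"
    have A: "(\<lambda>h. ?A h - 1) \<in> O[ILW r](\<lambda>h. h ^ 2)"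
      using near_one_bracket[OF params(1,2) m(1)] by (simp add: near_one_def)
    have D: "(\<lambda>h. ?D h - ?E h) \<in> O[ILW r](\<lambda>h. h ^ 2)"
      using dressing_expansion params(1,3) m(1) by blast
    have D0: "?D \<in> O[ILW r](\<lambda>h. h ^ 0)"
      using near_one_dressing[OF params(1,3), of "int m"] m(1) by (intro near_one_bounded) auto
    have "(\<lambda>h. (csqrt (beta r) * h)\<^sup>2 * ((?A h - 1) * ?D h + (?D h - ?E h))) \<in> O[ILW r](\<lambda>h. h ^ 4)"
      by (rule bigo_power_mult[of _ r 2 _ 2 4, OF scaled_power_bigo])
        (intro sum_in_bigo(1) D bigo_power_mult[OF A D0], simp_all)
    moreover have "\<forall>\<^sub>F h in ILW r. Z_weight r \<tau> f h ms ls - Z_cubic r \<tau> h ms ls =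
       (csqrt (beta r) * h)\<^sup>2 * ((?A h - 1) * ?D h + (?D h - ?E h))"
    proof -
      have "\<forall>\<^sub>F h in ILW r. \<forall>m>0. f m h \<noteq> 0" using params(4) by (simp add: admissible_scaling_def)
      then show ?thesis using eventually_ILW_nz[of r]
      proof eventually_elim
        case (elim h)
        then have "unit_scale r h \<noteq> 0" using params(2) by (simp add: unit_scale_def)
        then have pair: "osc_scale r f h (- int m) * osc_scale r f h (int m) = 2 / of_nat m * bracket r h m"
          using osc_scale_pair[OF m(1)] elim m(1) by blast
        have "Z_weight r \<tau> f h ms ls = ?D h * (osc_scale r f h (- int m) * osc_scale r f h (int m))"
          using m(1) by (simp add: Z_weight_def word_weight_def m dressing_def[of r \<tau> h "- int m"])
        also have "\<dots> = beta r * h\<^sup>2 * ?A h * ?D h"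
          unfolding pair using elim params(2) by simp
        finally have Z: "Z_weight r \<tau> f h ms ls = beta r * h\<^sup>2 * ?A h * ?D h" .
        have "Z_cubic r \<tau> h ms ls = beta r * h\<^sup>2 * ?E h"
          by (simp add: Z_cubic_def m)
        moreover have "(csqrt (beta r) * h)\<^sup>2 = beta r * h\<^sup>2" by (simp add: power_mult_distrib)
        ultimately show ?case unfolding Z by (simp only: right_diff_distrib left_diff_distrib distrib_left) simp
      qed
    qed
    ultimately show ?thesis by (rule bigo_eventually_eq)
  next
    case 3
    then have "length ms = 0 \<and> length ls = 3 \<or> length ms = 1 \<and> length ls = 2
       \<or> length ms = 2 \<and> length ls = 1 \<or> length ms = 3 \<and> length ls = 0"
      by linarith
    moreover have "length ms \<noteq> 0" "length ls \<noteq> 0"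
      using nz bal 3 by (auto simp: length_Suc_conv numeral_3_eq_3)
    ultimately have "fact (length ms) * fact (length ls) = (2 :: complex)" by auto
    moreover have "Z_cubic r \<tau> h ms ls = unit_scale r h ^ 3 / 2" for h
      using 3 by (auto simp: Z_cubic_def)
    ultimately show ?thesis using Z_weight_approx[OF nz 3[symmetric]] by (simp only:) simp
  next
    case 4
    then have "Z_cubic r \<tau> h ms ls = 0" for h by (auto simp: Z_cubic_def)
    then show ?thesis using Z_weight_bigo[OF nz 4] by simp
  qed
qed

text \<open>Writing \<open>t = t\<^sub>0 + \<beta> h\<^sup>2 t\<^sub>2 + O(h\<^sup>4)\<close> and \<open>z\<close> for the two coefficients, \<open>t z\<close> differs from \<open>t\<^sub>0 z + \<beta> h\<^sup>2 t\<^sub>2 z\<close> by \<open>O(h\<^sup>4)\<close>, and in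
  either summand \<open>z\<close> may be replaced by its approximation of the matching accuracy. If \<open>t\<^sub>0 \<noteq> 0\<close>, the first word
  is empty, so the second one has total mode \<open>0\<close>.\<close>

lemma product_expansion:
  assumes "admissible_scaling r g" "(ms', ls') \<in> words d n" "(ms, ls) \<in> words d (- n)"
  shows "(\<lambda>h. TDV_weight r \<pi> g h ms' ls' * Z_weight r \<tau> f h ms ls
     - ((if ms' = [] \<and> ls' = [] then 2 * Z_cubic r \<tau> h ms ls else 0)
        + beta r * h\<^sup>2 * Virasoro_weight r \<pi> n ms' ls' * Z_linear r h ms ls)) \<in> O[ILW r](\<lambda>h. h ^ 4)"
proof -
  let ?T = "\<lambda>h. TDV_weight r \<pi> g h ms' ls'"
  let ?Z = "\<lambda>h. Z_weight r \<tau> f h ms ls"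
  let ?V = "Virasoro_weight r \<pi> n ms' ls'"
  let ?e = "if ms' = [] \<and> ls' = [] then 2 else 0 :: complex"
  have nz: "0 \<notin> set ms" "0 \<notin> set ls" using assms(3) by (auto simp: words_def)
  have Z0: "?Z \<in> O[ILW r](\<lambda>h. h ^ 0)" by (rule Z_weight_bigo[OF nz]) simp
  have 1: "(\<lambda>h. (?T h - (?e + beta r * h\<^sup>2 * ?V)) * ?Z h) \<in> O[ILW r](\<lambda>h. h ^ 4)"
    by (rule bigo_power_mult[OF TDV_weight_expansion[OF params(1,2) assms(1,2)] Z0]) simp
  have 2: "(\<lambda>h. (beta r * ?V) * (h\<^sup>2 * (?Z h - Z_linear r h ms ls))) \<in> O[ILW r](\<lambda>h. h ^ 4)"
    by (rule bigo_power_mult[of "\<lambda>h. beta r * ?V" r 0 _ 4 4, OF const_bigo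
          bigo_power_mult[of "\<lambda>h. h\<^sup>2" r 2 _ 2 4, OF power_bigo_power Z_weight_linear[OF assms(3)]]])
      simp_all
  have 3: "(\<lambda>h. if ms' = [] \<and> ls' = [] then 2 * (?Z h - Z_cubic r \<tau> h ms ls) else 0) \<in> O[ILW r](\<lambda>h. h ^ 4)"
  proof (cases "ms' = [] \<and> ls' = []")
    case True
    then have "n = 0" using assms(2) by (auto simp: words_def)
    then show ?thesis
      using True assms(3) bigo_power_mult[OF const_bigo Z_weight_cubic, of ms ls d 4 2] by simp
  next
    case False
    then show ?thesis by (simp only: if_False zero_in_bigo)
  qed
  have "(\<lambda>h. (?T h - (?e + beta r * h\<^sup>2 * ?V)) * ?Z h + (beta r * ?V) * (h\<^sup>2 * (?Z h - Z_linear r h ms ls))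
     + (if ms' = [] \<and> ls' = [] then 2 * (?Z h - Z_cubic r \<tau> h ms ls) else 0)) \<in> O[ILW r](\<lambda>h. h ^ 4)"
    by (intro sum_in_bigo(1) 1 2 3)
  moreover have "(?T h - (?e + beta r * h\<^sup>2 * ?V)) * ?Z h + (beta r * ?V) * (h\<^sup>2 * (?Z h - Z_linear r h ms ls))
     + (if ms' = [] \<and> ls' = [] then 2 * (?Z h - Z_cubic r \<tau> h ms ls) else 0) =
    ?T h * ?Z h - ((if ms' = [] \<and> ls' = [] then 2 * Z_cubic r \<tau> h ms ls else 0)
        + beta r * h\<^sup>2 * ?V * Z_linear r h ms ls)" for h
    by (simp add: algebra_simps)
  ultimately show ?thesis by (simp only:)
qed

end

section \<open>The Virasoro modes and the cubic sum\<close>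

lemma eq_mod_h4_scal:
  assumes "(\<lambda>h. c h - e h) \<in> O[ILW r](\<lambda>h. h ^ 4)"
  shows "eq_mod_h4 r (\<lambda>h. scal (c h) w) (\<lambda>h. scal (e h) w)"
  unfolding eq_mod_h4_def
proof
  fix M
  have "(\<lambda>h. (c h - e h) * lookup w M) \<in> O[ILW r](\<lambda>h. h ^ 4)"
    by (rule bigo_power_mult[OF assms const_bigo]) simp
  then show "(\<lambda>h. lookup (scal (c h) w - scal (e h) w) M) \<in> O[ILW r](\<lambda>h. h ^ 4)"
    by (simp add: lookup_minus left_diff_distrib)
qed

lemma eq_mod_h4_sum:
  assumes "\<And>i. i \<in> I \<Longrightarrow> eq_mod_h4 r (u i) (w i)"
  shows "eq_mod_h4 r (\<lambda>h. \<Sum>i\<in>I. u i h) (\<lambda>h. \<Sum>i\<in>I. w i h)"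
  unfolding eq_mod_h4_def
proof
  fix M
  have "(\<lambda>h. \<Sum>i\<in>I. lookup (u i h - w i h) M) \<in> O[ILW r](\<lambda>h. h ^ 4)"
    by (rule big_sum_in_bigo) (use assms in \<open>simp add: eq_mod_h4_def\<close>)
  then show "(\<lambda>h. lookup ((\<Sum>i\<in>I. u i h) - (\<Sum>i\<in>I. w i h)) M) \<in> O[ILW r](\<lambda>h. h ^ 4)"
    by (simp add: lookup_sum lookup_minus sum_subtractf)
qed

lemma eq_mod_h4_eventually_eq:
  assumes "eq_mod_h4 r u w" "\<forall>\<^sub>F h in ILW r. u' h = u h"
  shows "eq_mod_h4 r u' w"
  unfolding eq_mod_h4_def
proof
  fix M
  show "(\<lambda>h. lookup (u' h - w h) M) \<in> O[ILW r](\<lambda>h. h ^ 4)"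
  proof (rule bigo_eventually_eq)
    show "(\<lambda>h. lookup (u h - w h) M) \<in> O[ILW r](\<lambda>h. h ^ 4)"
      using assms(1) by (simp add: eq_mod_h4_def)
    show "\<forall>\<^sub>F h in ILW r. lookup (u' h - w h) M = lookup (u h - w h) M"
      using assms(2) by eventually_elim simp
  qed
qed

text \<open>Two candidates for the coefficient of \<open>h\<^sup>2\<close> would differ by a constant \<open>\<delta>\<close> with \<open>\<delta> h\<^sup>2 = O(h\<^sup>4)\<close>, which in a proper
  filter at zero forces \<open>\<delta> = 0\<close>. This justifies the definite description in the definition of \<open>L\<^sub>n\<close>.\<close>

lemma eq_mod_h4_unique:
  assumes "r \<noteq> 0" "c \<noteq> 0"
    and "eq_mod_h4 r u (\<lambda>h. A h + scal (c * h\<^sup>2) (w + B))"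
    and "eq_mod_h4 r u (\<lambda>h. A h + scal (c * h\<^sup>2) (w' + B))"
  shows "w = w'"
proof (rule poly_mapping_eqI, rule ccontr)
  fix M
  let ?\<delta> = "lookup w M - lookup w' M"
  assume "lookup w M \<noteq> lookup w' M"
  then have nz: "c * ?\<delta> \<noteq> 0" using assms(2) by simp
  have "(\<lambda>h. lookup (u h - (A h + scal (c * h\<^sup>2) (w' + B))) M
      - lookup (u h - (A h + scal (c * h\<^sup>2) (w + B))) M) \<in> O[ILW r](\<lambda>h. h ^ 4)"
    using assms(3,4) by (intro sum_in_bigo(2)) (simp_all add: eq_mod_h4_def)
  then have "(\<lambda>h. (c * ?\<delta>) * h\<^sup>2) \<in> O[ILW r](\<lambda>h. h ^ 4)"
    by (simp add: lookup_minus lookup_add algebra_simps)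
  then have "(\<lambda>h. h\<^sup>2) \<in> O[ILW r](\<lambda>h. h ^ 4)"
    using nz by (simp only: cmult_in_bigo_iff simp_thms)
  then have "(\<lambda>h. h\<^sup>2 * 1) \<in> O[ILW r](\<lambda>h. h\<^sup>2 * h\<^sup>2)"
    by (simp flip: power_add)
  then have "(\<lambda>h. 1 :: complex) \<in> O[ILW r](\<lambda>h. h\<^sup>2)"
    using eventually_ILW_nz[of r] by (subst (asm) landau_o.big.mult_cancel_left) (auto elim: eventually_mono)
  then have "near_one r 2 (\<lambda>h. 0)"
    by (simp add: near_one_def)
  from near_one_tendsto[OF this] have "((\<lambda>h. 0 :: complex) \<longlongrightarrow> 1) (ILW r)" by simp
  then have "(0 :: complex) = 1"
    using tendsto_unique[OF ILW_neq_bot[OF assms(1)] tendsto_const] by blast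
  then show False by simp
qed

lemma deg_le_scal: "deg_le i d v \<Longrightarrow> deg_le i d (scal c v)"
  by (simp add: deg_le_def)

lemma deg_le_sum: "(\<And>x. x \<in> I \<Longrightarrow> deg_le i d (F x)) \<Longrightarrow> deg_le i d (sum F I)"
  unfolding deg_le_def lookup_sum by (meson sum.neutral)

lemma words_eq_empty: "n > d \<Longrightarrow> words d n = {}"
  by (auto simp: words_def)

lemma word_Nil [simp]: "word C i [] [] v = v"
  by (simp add: word_def)

lemma Nil_in_words: "([], []) \<in> words (int D) n \<longleftrightarrow> n = 0"
  by (auto simp: words_def)

text \<open>The operator \<open>L\<^sub>n\<close> plus its constant \<open>(1 - \<beta>)\<^sup>2 / (4 \<beta>)\<close> at \<open>n = 0\<close>, on vectors of degree at most \<open>D\<close>.\<close>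

definition Vir :: "complex \<Rightarrow> complex \<Rightarrow> nat \<Rightarrow> int \<Rightarrow> osc fock \<Rightarrow> osc fock" where
  "Vir r \<pi> D n v = (\<Sum>(ms, ls)\<in>words (int D) n.
     scal (Virasoro_weight r \<pi> n ms ls) (word osc_norm Bar ms ls v))"

lemma fock_linear_Vir: "fock_linear (Vir r \<pi> D n)"
  unfolding Vir_def case_prod_unfold
  by (auto intro!: fock_linearI simp: fock_linear_add[OF fock_linear_word] fock_linear_scal[OF fock_linear_word]
      scal_add_right sum.distrib scal_sum_right mult_ac)

lemma sum_Nil_word:
  "(\<Sum>(ms, ls)\<in>words (int D) n. if ms = [] \<and> ls = [] then u else 0) = (if n = 0 then u else 0)"
proof -
  have "(\<Sum>(ms, ls)\<in>words (int D) n. if ms = [] \<and> ls = [] then u else 0) =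
    (\<Sum>p\<in>words (int D) n. if p = ([], []) then u else 0)"
    by (rule sum.cong) (auto split: if_splits)
  then show ?thesis by (simp add: Nil_in_words)
qed

context
  fixes r \<tau> :: complex and f g :: "nat \<Rightarrow> complex \<Rightarrow> complex"
  assumes params: "r \<noteq> 0" "beta r \<noteq> 0" "\<forall>m>0. pp \<tau> ^ m \<noteq> 1" "admissible_scaling r f" "admissible_scaling r g"
begin

lemma eventually_generic: "\<forall>\<^sub>F h in ILW r. generic_parameters r h f g"
proof -
  have "\<forall>\<^sub>F h in ILW r. \<forall>m>0. f m h \<noteq> 0" "\<forall>\<^sub>F h in ILW r. \<forall>m>0. g m h \<noteq> 0"
    using params(4,5) by (simp_all add: admissible_scaling_def)
  then show ?thesis
    using eventually_ILW_nz[of r] eventually_ILW_root[of r]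
    by eventually_elim (simp add: generic_parameters_def params(2))
qed

lemma TDV_expansion:
  assumes "deg_le Bar (int D) v"
  shows "eq_mod_h4 r (\<lambda>h. transport (rescale r \<tau> f g h) (TDV r \<pi> h n) v)
     (\<lambda>h. (if n = 0 then scal 2 v else 0) + scal (beta r * h\<^sup>2) (Vir r \<pi> D n v))"
proof -
  let ?W = "\<lambda>(ms, ls). word osc_norm Bar ms ls v"
  let ?e = "\<lambda>(ms, ls). if ms = [] \<and> ls = [] then 2 else 0 :: complex"
  have 1: "eq_mod_h4 r (\<lambda>h. \<Sum>w\<in>words (int D) n. scal (case_prod (TDV_weight r \<pi> g h) w) (?W w))
      (\<lambda>h. \<Sum>w\<in>words (int D) n. scal (?e w + beta r * h\<^sup>2 * case_prod (Virasoro_weight r \<pi> n) w) (?W w))"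
  proof (rule eq_mod_h4_sum, rule eq_mod_h4_scal)
    fix w assume w: "w \<in> words (int D) n"
    obtain ms ls where "w = (ms, ls)" by (cases w)
    with TDV_weight_expansion[OF params(1,2,5), of ms ls "int D" n] w
    show "(\<lambda>h. case_prod (TDV_weight r \<pi> g h) w - (?e w + beta r * h\<^sup>2 * case_prod (Virasoro_weight r \<pi> n) w))
       \<in> O[ILW r](\<lambda>h. h ^ 4)" by simp
  qed
  have 2: "(\<Sum>w\<in>words (int D) n. scal (?e w + beta r * h\<^sup>2 * case_prod (Virasoro_weight r \<pi> n) w) (?W w)) =
      (if n = 0 then scal 2 v else 0) + scal (beta r * h\<^sup>2) (Vir r \<pi> D n v)" for h
  proof -
    have "(\<Sum>w\<in>words (int D) n. scal (?e w) (?W w)) = (\<Sum>(ms, ls)\<in>words (int D) n. if ms = [] \<and> ls = [] then scal 2 v else 0)"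
      by (rule sum.cong) auto
    then show ?thesis
      unfolding sum_Nil_word by (simp add: scal_add_left sum.distrib Vir_def scal_sum_right case_prod_unfold)
  qed
  have "\<forall>\<^sub>F h in ILW r. transport (rescale r \<tau> f g h) (TDV r \<pi> h n) v =
      (\<Sum>w\<in>words (int D) n. scal (case_prod (TDV_weight r \<pi> g h) w) (?W w))"
    using eventually_generic
  proof eventually_elim
    case (elim h)
    show ?case
      unfolding generic_parameters.transport_TDV[OF elim] osc_TDV_eq[OF assms] by (simp add: case_prod_unfold)
  qed
  from eq_mod_h4_eventually_eq[OF 1[unfolded 2] this] show ?thesis .
qed

lemma Lop_eq:
  assumes "deg_le Bar (int D) v"
  shows "Lop r \<pi> (rescale r \<tau> f g) n v =
    Vir r \<pi> D n v - (if n = 0 then scal ((1 - beta r)\<^sup>2 / (4 * beta r)) v else 0)"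
  unfolding Lop_def
proof (rule the_equality)
  let ?c = "if n = 0 then scal ((1 - beta r)\<^sup>2 / (4 * beta r)) v else 0"
  show *: "eq_mod_h4 r (\<lambda>h. transport (rescale r \<tau> f g h) (TDV r \<pi> h n) v)
     (\<lambda>h. (if n = 0 then scal 2 v else 0) + scal (beta r * h ^ 2) ((Vir r \<pi> D n v - ?c) + ?c))"
    using TDV_expansion[OF assms] by simp
  show "w = Vir r \<pi> D n v - ?c"
    if "eq_mod_h4 r (\<lambda>h. transport (rescale r \<tau> f g h) (TDV r \<pi> h n) v)
     (\<lambda>h. (if n = 0 then scal 2 v else 0) + scal (beta r * h ^ 2) (w + ?c))" for w
    by (rule eq_mod_h4_unique[OF params(1,2) that *])
qed

end

lemma heis_commute:
  assumes "m + n \<noteq> 0 \<or> i \<noteq> j"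
  shows "heis C i m (heis C j n v) = heis C j n (heis C i m v)"
  using assms
  by (auto simp: heis_def pdiff_var_mult pdiff_commute scal_mult mult.left_commute mult_ac[where 'a = complex]
      fock_linear_scal[OF fock_linear_pdiff] fock_linear_0[OF fock_linear_pdiff])

lemma a_commute: "m + n \<noteq> 0 \<Longrightarrow> a m (a n v) = a n (a m v)"
  unfolding a_def by (rule heis_commute) simp

lemma fock_linear_a: "fock_linear (a n)"
  by (simp add: a_def)

lemma a_eq_0:
  assumes "deg_le Diag d v" "n > d" "n \<ge> 0"
  shows "a n v = 0"
  unfolding a_def using deg_le_neg[OF deg_le_heis[OF assms(1), of Diag n osc_norm]] assms(2) by simp

definition small_pairs :: "nat \<Rightarrow> (nat \<times> nat) set" where
  "small_pairs D = {(i, j). i > 0 \<and> j > 0 \<and> i + j \<le> D}"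

lemma finite_small_pairs [simp]: "finite (small_pairs D)"
  by (rule finite_subset[of _ "{..D} \<times> {..D}"]) (auto simp: small_pairs_def)

definition cubic_pair :: "osc fock \<Rightarrow> nat \<times> nat \<Rightarrow> osc fock" where
  "cubic_pair v = (\<lambda>(i, j).
     word osc_norm Diag [i + j] [i, j] v + word osc_norm Diag [i, j] [i + j] v)"

text \<open>One of the three integers is, up to sign, the sum of the absolute values of the other two. Its
  position and its sign make six cases.\<close>

lemma zero_sum_triple_cases:
  fixes k l m :: int
  assumes "k \<noteq> 0" "l \<noteq> 0" "m \<noteq> 0" "k + l + m = 0"
  obtains i j :: nat where "i > 0" "j > 0"
    "(k, l, m) \<in> {(- int (i + j), int i, int j), (int i, - int (i + j), int j), (int i, int j, - int (i + j)),
       (int (i + j), - int i, - int j), (- int i, int (i + j), - int j), (- int i, - int j, int (i + j))}"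
proof -
  consider "l > 0" "m > 0" | "k > 0" "m > 0" | "k > 0" "l > 0"
    | "l < 0" "m < 0" | "k < 0" "m < 0" | "k < 0" "l < 0"
    using assms by linarith
  then show ?thesis
  proof cases
    case 1 with assms that[of "nat l" "nat m"] show ?thesis by auto
  next
    case 2 with assms that[of "nat k" "nat m"] show ?thesis by auto
  next
    case 3 with assms that[of "nat k" "nat l"] show ?thesis by auto
  next
    case 4 with assms that[of "nat (- l)" "nat (- m)"] show ?thesis by auto
  next
    case 5 with assms that[of "nat (- k)" "nat (- m)"] show ?thesis by auto
  next
    case 6 with assms that[of "nat (- k)" "nat (- l)"] show ?thesis by auto
  qed
qed

text \<open>No two members of a triple of nonzero integers with sum zero cancel, so the three operators commute
  and the product can be normally ordered. Each pair \<open>(i, j)\<close> then arises from three orderings of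
  \<open>a\<^sub>-\<^sub>i\<^sub>-\<^sub>j a\<^sub>i a\<^sub>j\<close> and three of \<open>a\<^sub>-\<^sub>i a\<^sub>-\<^sub>j a\<^sub>i\<^sub>+\<^sub>j\<close>.\<close>

lemma cubic_sum:
  assumes v: "deg_le Diag (int D) v"
  shows "Sum_any (\<lambda>(k::int, l::int, m::int).
      if k \<noteq> 0 \<and> l \<noteq> 0 \<and> m \<noteq> 0 \<and> k + l + m = 0 then a k (a l (a m v)) else 0) =
    scal 3 (\<Sum>p\<in>small_pairs D. cubic_pair v p)"
proof -
  let ?F = "\<lambda>(k::int, l::int, m::int).
      if k \<noteq> 0 \<and> l \<noteq> 0 \<and> m \<noteq> 0 \<and> k + l + m = 0 then a k (a l (a m v)) else 0"
  let ?A = "\<lambda>(i, j). word osc_norm Diag [i + j] [i, j] v"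
  let ?B = "\<lambda>(i, j). word osc_norm Diag [i, j] [i + j] v"
  \<comment> \<open>The first three orderings give the value \<open>?A\<close>, the last three \<open>?B\<close>.\<close>
  define G :: "(nat \<times> nat \<Rightarrow> int \<times> int \<times> int) list" where "G =
    [\<lambda>(i, j). (- int (i + j), int i, int j), \<lambda>(i, j). (int i, - int (i + j), int j), \<lambda>(i, j). (int i, int j, - int (i + j)),
     \<lambda>(i, j). (int (i + j), - int i, - int j), \<lambda>(i, j). (- int i, int (i + j), - int j), \<lambda>(i, j). (- int i, - int j, int (i + j))]"
  have A: "?F ((G ! x) (i, j)) = ?A (i, j)" if "x < 3" "i > 0" "j > 0" for x i j
  proof -
    have "x = 0 \<or> x = 1 \<or> x = 2" using that(1) by auto
    then show ?thesis
      using that(2,3) a_commute[of "int i" "- int (i + j)"] a_commute[of "int j" "- int (i + j)"]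
      by (auto simp: G_def word_def simp flip: a_def)
  qed
  have B: "?F ((G ! x) (i, j)) = ?B (i, j)" if "x \<in> {3..<6}" "i > 0" "j > 0" for x i j
  proof -
    have "x = 3 \<or> x = 4 \<or> x = 5" using that(1) by auto
    then show ?thesis
      using that(2,3) a_commute[of "int (i + j)" "- int i"] a_commute[of "int (i + j)" "- int j"]
      by (auto simp: G_def word_def simp flip: a_def)
  qed
  have A0: "?A (i, j) = 0" and B0: "?B (i, j) = 0" if "i + j > D" for i j
    using that annihilators_eq_0[OF v, of "[i, j]" osc_norm] annihilators_eq_0[OF v, of "[i + j]" osc_norm]
    by (auto simp: word_def fock_linear_0)
  let ?S = "(\<lambda>(x, p). (G ! x) p) ` ({..<6} \<times> small_pairs D)"
  have inj: "inj_on (\<lambda>(x, p). (G ! x) p) ({..<6} \<times> small_pairs D)"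
  proof -
    have "{..<6 :: nat} = {0, 1, 2, 3, 4, 5}" by auto
    then show ?thesis
      by (auto simp: inj_on_def G_def small_pairs_def)
  qed
  have "Sum_any ?F = sum ?F ?S"
  proof (rule Sum_any.expand_superset)
    show "finite ?S" by simp
    show "{t. ?F t \<noteq> 0} \<subseteq> ?S"
    proof
      fix t assume "t \<in> {t. ?F t \<noteq> 0}"
      then have nz: "?F t \<noteq> 0" by simp
      obtain k l m where t: "t = (k, l, m)" by (cases t)
      from nz have "k \<noteq> 0" "l \<noteq> 0" "m \<noteq> 0" "k + l + m = 0" by (auto simp: t split: if_splits)
      then obtain i j where ij: "i > 0" "j > 0"
        "(k, l, m) \<in> {(- int (i + j), int i, int j), (int i, - int (i + j), int j), (int i, int j, - int (i + j)),
         (int (i + j), - int i, - int j), (- int i, int (i + j), - int j), (- int i, - int j, int (i + j))}"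
        by (rule zero_sum_triple_cases)
      have "\<exists>x<6. t = (G ! x) (i, j)"
      proof -
        have "t = (G ! 0) (i, j) \<or> t = (G ! 1) (i, j) \<or> t = (G ! 2) (i, j) \<or> t = (G ! 3) (i, j) \<or> t = (G ! 4) (i, j) \<or> t = (G ! 5) (i, j)"
          using ij(3) by (auto simp: t G_def)
        moreover have "(0::nat) < 6" "(1::nat) < 6" "(2::nat) < 6" "(3::nat) < 6" "(4::nat) < 6" "(5::nat) < 6" by simp_all
        ultimately show ?thesis by blast
      qed
      then obtain x where x: "x < 6" "t = (G ! x) (i, j)" by blast
      have "i + j \<le> D"
      proof (rule ccontr)
        assume "\<not> i + j \<le> D"
        then have "?A (i, j) = 0" "?B (i, j) = 0" using A0 B0 by simp_all
        then have "?F t = 0" using A[of x i j] B[of x i j] ij(1,2) x by (cases "x < 3") auto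
        with nz show False by simp
      qed
      with ij x show "t \<in> ?S" by (force simp: small_pairs_def)
    qed
  qed
  also have "\<dots> = (\<Sum>x\<in>{..<6}. \<Sum>p\<in>small_pairs D. ?F ((G ! x) p))"
    unfolding sum.reindex[OF inj] sum.cartesian_product by (rule sum.cong) auto
  also have "\<dots> = (\<Sum>x\<in>{..<6::nat}. \<Sum>p\<in>small_pairs D. if x < 3 then ?A p else ?B p)"
    using A B by (intro sum.cong refl) (auto simp: small_pairs_def)
  also have "\<dots> = scal 3 (\<Sum>p\<in>small_pairs D. cubic_pair v p)"
  proof -
    have three: "scal 3 w = w + w + w" for w :: "osc fock"
      by (rule poly_mapping_eqI) (simp only: lookup_scal lookup_add, simp)
    have "{..<6 :: nat} = {0, 1, 2, 3, 4, 5}" by auto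
    then show ?thesis
      by (simp add: three cubic_pair_def case_prod_unfold sum.distrib add_ac)
  qed
  finally show ?thesis .
qed

section \<open>Collecting the terms\<close>

text \<open>For each nonzero mode there is exactly one word of length \<open>1\<close>.\<close>

lemma linear_part:
  assumes "n \<in> {- int D..int D}"
  shows "(\<Sum>(ms, ls)\<in>words (int D) (- n). scal (Z_linear r h ms ls) (word osc_norm Diag ms ls v)) =
    (if n = 0 then v else scal (unit_scale r h) (a (- n) v))"
proof -
  let ?w = "if n > 0 then ([nat n], []) else if n < 0 then ([], [nat (- n)]) else ([], []) :: nat list \<times> nat list"
  let ?u = "if n = 0 then v else scal (unit_scale r h) (a (- n) v)"
  have w: "?w \<in> words (int D) (- n)"
    using assms by (auto simp: words_def)
  have "(\<Sum>(ms, ls)\<in>words (int D) (- n). scal (Z_linear r h ms ls) (word osc_norm Diag ms ls v)) =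
     (\<Sum>p\<in>words (int D) (- n). if p = ?w then ?u else 0)"
  proof (rule sum.cong[OF refl])
    fix p assume p: "p \<in> words (int D) (- n)"
    obtain ms ls where msls: "p = (ms, ls)" by (cases p)
    have mem: "0 \<notin> set ms" "0 \<notin> set ls" "int (sum_list ls) - int (sum_list ms) = - n"
      using p by (auto simp: msls words_def)
    consider "ms = []" "ls = []" | l where "ms = []" "ls = [l]" | m where "ms = [m]" "ls = []"
      | "length ms + length ls \<ge> 2"
    proof -
      have "length ms + length ls = 0 \<or> length ms + length ls = Suc 0 \<or> length ms + length ls \<ge> 2"
        by linarith
      then show ?thesis using that by (auto simp: add_is_1 length_Suc_conv)
    qed
    then show "(case p of (ms, ls) \<Rightarrow> scal (Z_linear r h ms ls) (word osc_norm Diag ms ls v)) = (if p = ?w then ?u else 0)"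
    proof cases
      case 1
      then show ?thesis using mem by (simp add: msls Z_linear_def)
    next
      case 2
      then have "n = - int l" "l > 0" using mem by auto
      then show ?thesis using 2 by (simp add: msls Z_linear_def word_def a_def)
    next
      case 3
      then have "n = int m" "m > 0" using mem by auto
      then show ?thesis using 3 by (simp add: msls Z_linear_def word_def a_def)
    next
      case 4
      then show ?thesis by (auto simp: msls Z_linear_def)
    qed
  qed
  also have "\<dots> = ?u" using w by simp
  finally show ?thesis .
qed

text \<open>The words of total mode \<open>0\<close> and length at most \<open>3\<close> are the empty one, the pairs \<open>a\<^sub>-\<^sub>m a\<^sub>m\<close>, and the two kinds
  of triples.\<close>

lemma cubic_part:
  "(\<Sum>(ms, ls)\<in>words (int D) 0. scal (Z_cubic r \<tau> h ms ls) (word osc_norm Diag ms ls v)) =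
    v + scal (beta r * h\<^sup>2) ((\<Sum>m\<in>{1..D}. a (- int m) (a (int m) v))
         - scal (h / r) (\<Sum>m\<in>{1..D}. scal (of_nat m * coth (of_nat m * \<tau>)) (a (- int m) (a (int m) v))))
      + scal (unit_scale r h ^ 3 / 2) (\<Sum>p\<in>small_pairs D. cubic_pair v p)"
proof -
  let ?G = "\<lambda>(ms, ls). scal (Z_cubic r \<tau> h ms ls) (word osc_norm Diag ms ls v)"
  let ?X0 = "{([], [])} :: (nat list \<times> nat list) set"
  let ?X2 = "(\<lambda>m. ([m], [m])) ` {1..D}"
  let ?X3 = "(\<lambda>(i, j). ([i + j], [i, j])) ` small_pairs D"
  let ?X4 = "(\<lambda>(i, j). ([i, j], [i + j])) ` small_pairs D"
  have "sum ?G (words (int D) 0) = sum ?G (?X0 \<union> ?X2 \<union> ?X3 \<union> ?X4)"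
  proof (rule sum.mono_neutral_right)
    show "?X0 \<union> ?X2 \<union> ?X3 \<union> ?X4 \<subseteq> words (int D) 0"
      by (auto simp: words_def small_pairs_def)
    show "\<forall>p\<in>words (int D) 0 - (?X0 \<union> ?X2 \<union> ?X3 \<union> ?X4). ?G p = 0"
    proof
      fix p assume p: "p \<in> words (int D) 0 - (?X0 \<union> ?X2 \<union> ?X3 \<union> ?X4)"
      obtain ms ls where msls: "p = (ms, ls)" by (cases p)
      have mem: "0 \<notin> set ms" "0 \<notin> set ls" "sum_list ls = sum_list ms" "sum_list ls \<le> D"
        using p by (auto simp: msls words_def)
      have "length ms + length ls \<noteq> 2"
      proof
        assume "length ms + length ls = 2"
        then obtain m where "m > 0" "ms = [m]" "ls = [m]"
          using balanced_word_of_length_2 p unfolding msls by blast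
        with mem(4) p show False by (auto simp: msls)
      qed
      moreover have "length ms + length ls \<noteq> 3"
      proof
        assume 3: "length ms + length ls = 3"
        then have "length ms = 0 \<and> length ls = 3 \<or> length ms = 1 \<and> length ls = 2
           \<or> length ms = 2 \<and> length ls = 1 \<or> length ms = 3 \<and> length ls = 0"
          by linarith
        then consider i j k where "ms = []" "ls = [i, j, k]" | i j k where "ms = [k]" "ls = [i, j]"
          | i j k where "ms = [i, j]" "ls = [k]" | i j k where "ms = [i, j, k]" "ls = []"
          by (auto simp: numeral_3_eq_3 numeral_2_eq_2 length_Suc_conv)
        then show False
        proof cases
          case 2
          then have "(i, j) \<in> small_pairs D" "p = (\<lambda>(i, j). ([i + j], [i, j])) (i, j)"
            using mem by (auto simp: small_pairs_def msls)
          then show False using p by blast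
        next
          case 3
          then have "(i, j) \<in> small_pairs D" "p = (\<lambda>(i, j). ([i, j], [i + j])) (i, j)"
            using mem by (auto simp: small_pairs_def msls)
          then show False using p by blast
        qed (use mem in auto)
      qed
      moreover have "\<not> (ms = [] \<and> ls = [])" using p by (auto simp: msls)
      ultimately have "Z_cubic r \<tau> h ms ls = 0" unfolding Z_cubic_def by presburger
      then show "?G p = 0" by (simp add: msls)
    qed
  qed simp
  also have "\<dots> = sum ?G ?X0 + sum ?G ?X2 + sum ?G ?X3 + sum ?G ?X4"
  proof -
    have "sum ?G (?X0 \<union> ?X2 \<union> ?X3 \<union> ?X4) = sum ?G (?X0 \<union> ?X2 \<union> ?X3) + sum ?G ?X4"
      by (rule sum.union_disjoint) auto
    also have "sum ?G (?X0 \<union> ?X2 \<union> ?X3) = sum ?G (?X0 \<union> ?X2) + sum ?G ?X3"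
      by (rule sum.union_disjoint) auto
    also have "sum ?G (?X0 \<union> ?X2) = sum ?G ?X0 + sum ?G ?X2"
      by (rule sum.union_disjoint) auto
    finally show ?thesis .
  qed
  also have "sum ?G ?X0 = v" by (simp add: Z_cubic_def)
  also have "sum ?G ?X2 = scal (beta r * h\<^sup>2) ((\<Sum>m\<in>{1..D}. a (- int m) (a (int m) v))
         - scal (h / r) (\<Sum>m\<in>{1..D}. scal (of_nat m * coth (of_nat m * \<tau>)) (a (- int m) (a (int m) v))))"
  proof -
    have "sum ?G ?X2 = (\<Sum>m\<in>{1..D}. ?G ([m], [m]))"
      by (subst sum.reindex) (auto simp: inj_on_def)
    also have "\<dots> = (\<Sum>m\<in>{1..D}. scal (beta r * h\<^sup>2) (a (- int m) (a (int m) v)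
        - scal (h / r) (scal (of_nat m * coth (of_nat m * \<tau>)) (a (- int m) (a (int m) v)))))"
      by (intro sum.cong refl)
        (simp add: Z_cubic_def word_def scal_diff_right right_diff_distrib scal_diff_left mult_ac flip: a_def)
    finally show ?thesis by (simp only: scal_sum_right sum_subtractf scal_diff_right)
  qed
  also have "sum ?G ?X3 = (\<Sum>(i, j)\<in>small_pairs D. scal (unit_scale r h ^ 3 / 2) (word osc_norm Diag [i + j] [i, j] v))"
    by (subst sum.reindex) (auto simp: inj_on_def Z_cubic_def intro!: sum.cong)
  also have "sum ?G ?X4 = (\<Sum>(i, j)\<in>small_pairs D. scal (unit_scale r h ^ 3 / 2) (word osc_norm Diag [i, j] [i + j] v))"
    by (subst sum.reindex) (auto simp: inj_on_def Z_cubic_def intro!: sum.cong)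
  finally show ?thesis
    by (simp add: cubic_pair_def case_prod_unfold sum.distrib scal_add_right scal_sum_right add.assoc)
qed

context
  fixes r \<tau> :: complex and f g :: "nat \<Rightarrow> complex \<Rightarrow> complex"
  assumes params: "r \<noteq> 0" "beta r \<noteq> 0" "\<forall>m>0. pp \<tau> ^ m \<noteq> 1" "admissible_scaling r f" "admissible_scaling r g"
begin

text \<open>The first current acts on the output of the second one, whose degree in the barred oscillators is still at
  most \<open>D\<close>. Hence both the sum over modes and the sums over words are finite, with ranges that do not
  depend on \<open>h\<close>.\<close>

lemma local_IM1_words:
  assumes v: "\<And>i. deg_le i (int D) v" and gen: "generic_parameters r h f g"
  shows "transport (rescale r \<tau> f g h) (local_IM1 r \<tau> \<pi> h) v =
    (\<Sum>n\<in>{- int D..int D}. \<Sum>(ms', ls')\<in>words (int D) n. \<Sum>(ms, ls)\<in>words (int D) (- n).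
      scal (TDV_weight r \<pi> g h ms' ls' * Z_weight r \<tau> f h ms ls)
        (word osc_norm Bar ms' ls' (word osc_norm Diag ms ls v)))"
proof -
  let ?Z = "\<lambda>n. osc_DeltaZ r \<tau> f h n v"
  have Z: "deg_le Bar (int D) (?Z n)" for n
    unfolding osc_DeltaZ_eq[OF v]
    by (intro deg_le_sum) (auto intro!: deg_le_scal deg_le_word_other v)
  have modes: "osc_TDV r \<pi> g h n (?Z (- n)) =
      (\<Sum>(ms', ls')\<in>words (int D) n. \<Sum>(ms, ls)\<in>words (int D) (- n).
      scal (TDV_weight r \<pi> g h ms' ls' * Z_weight r \<tau> f h ms ls)
        (word osc_norm Bar ms' ls' (word osc_norm Diag ms ls v)))" for n
    unfolding osc_TDV_eq[OF Z]
    by (simp add: osc_DeltaZ_eq[OF v] fock_linear_sum[OF fock_linear_word] fock_linear_scal[OF fock_linear_word]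
        scal_sum_right case_prod_unfold)
  have "osc_TDV r \<pi> g h n (?Z (- n)) = 0" if "n \<notin> {- int D..int D}" for n
  proof -
    have "words (int D) n = {} \<or> words (int D) (- n) = {}"
      using that words_eq_empty[of "int D" n] words_eq_empty[of "int D" "- n"] by auto
    then show ?thesis unfolding modes by auto
  qed
  then have "Sum_any (\<lambda>n. osc_TDV r \<pi> g h n (?Z (- n))) = (\<Sum>n\<in>{- int D..int D}. osc_TDV r \<pi> g h n (?Z (- n)))"
    by (intro Sum_any.expand_superset subsetI) (simp, blast)
  then show ?thesis
    unfolding generic_parameters.transport_local_IM1[OF gen] by (simp only: modes)
qed

lemma expansion_words:
  assumes v: "\<And>i. deg_le i (int D) v"
  shows "(\<Sum>(ms', ls')\<in>words (int D) n. \<Sum>(ms, ls)\<in>words (int D) (- n).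
      scal ((if ms' = [] \<and> ls' = [] then 2 * Z_cubic r \<tau> h ms ls else 0)
        + beta r * h\<^sup>2 * Virasoro_weight r \<pi> n ms' ls' * Z_linear r h ms ls)
        (word osc_norm Bar ms' ls' (word osc_norm Diag ms ls v))) =
    (if n = 0 then scal 2 (\<Sum>(ms, ls)\<in>words (int D) 0. scal (Z_cubic r \<tau> h ms ls) (word osc_norm Diag ms ls v)) else 0)
    + scal (beta r * h\<^sup>2) (Vir r \<pi> D n
        (\<Sum>(ms, ls)\<in>words (int D) (- n). scal (Z_linear r h ms ls) (word osc_norm Diag ms ls v)))"
proof -
  let ?C = "\<Sum>(ms, ls)\<in>words (int D) (- n). scal (Z_cubic r \<tau> h ms ls) (word osc_norm Diag ms ls v)"
  let ?L = "\<Sum>(ms, ls)\<in>words (int D) (- n). scal (Z_linear r h ms ls) (word osc_norm Diag ms ls v)"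
  have "(\<Sum>(ms, ls)\<in>words (int D) (- n).
      scal ((if ms' = [] \<and> ls' = [] then 2 * Z_cubic r \<tau> h ms ls else 0)
        + beta r * h\<^sup>2 * Virasoro_weight r \<pi> n ms' ls' * Z_linear r h ms ls)
        (word osc_norm Bar ms' ls' (word osc_norm Diag ms ls v))) =
     (if ms' = [] \<and> ls' = [] then scal 2 ?C else 0)
       + scal (beta r * h\<^sup>2) (scal (Virasoro_weight r \<pi> n ms' ls') (word osc_norm Bar ms' ls' ?L))" for ms' ls'
  proof (cases "ms' = [] \<and> ls' = []")
    case True
    then show ?thesis
      by (simp add: fock_linear_sum[OF fock_linear_word] fock_linear_scal[OF fock_linear_word]
          scal_sum_right scal_add_left sum.distrib case_prod_unfold mult.assoc)
  next
    case False
    then show ?thesis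
      by (simp add: if_not_P[OF False] fock_linear_sum[OF fock_linear_word] fock_linear_scal[OF fock_linear_word]
          scal_sum_right case_prod_unfold mult.assoc)
  qed
  then have "(\<Sum>(ms', ls')\<in>words (int D) n. \<Sum>(ms, ls)\<in>words (int D) (- n).
      scal ((if ms' = [] \<and> ls' = [] then 2 * Z_cubic r \<tau> h ms ls else 0)
        + beta r * h\<^sup>2 * Virasoro_weight r \<pi> n ms' ls' * Z_linear r h ms ls)
        (word osc_norm Bar ms' ls' (word osc_norm Diag ms ls v))) =
    (\<Sum>(ms', ls')\<in>words (int D) n. if ms' = [] \<and> ls' = [] then scal 2 ?C else 0)
      + scal (beta r * h\<^sup>2) (Vir r \<pi> D n ?L)"
    by (simp only: Vir_def scal_sum_right sum.distrib case_prod_unfold)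
  then show ?thesis unfolding sum_Nil_word by simp
qed

lemma local_IM1_expansion:
  assumes v: "\<And>i. deg_le i (int D) v"
  shows "eq_mod_h4 r (\<lambda>h. transport (rescale r \<tau> f g h) (local_IM1 r \<tau> \<pi> h) v)
    (\<lambda>h. scal 2 (v + scal (beta r * h\<^sup>2) ((\<Sum>m\<in>{1..D}. a (- int m) (a (int m) v))
         - scal (h / r) (\<Sum>m\<in>{1..D}. scal (of_nat m * coth (of_nat m * \<tau>)) (a (- int m) (a (int m) v))))
      + scal (unit_scale r h ^ 3 / 2) (\<Sum>p\<in>small_pairs D. cubic_pair v p))
      + scal (beta r * h\<^sup>2) (Vir r \<pi> D 0 v
          + scal (unit_scale r h) (\<Sum>n\<in>{- int D..int D} - {0}. Vir r \<pi> D n (a (- n) v))))"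
proof -
  let ?W = "\<lambda>ms' ls' ms ls. word osc_norm Bar ms' ls' (word osc_norm Diag ms ls v)"
  let ?e = "\<lambda>h n ms' ls' ms ls. (if ms' = [] \<and> ls' = [] then 2 * Z_cubic r \<tau> h ms ls else 0)
        + beta r * h\<^sup>2 * Virasoro_weight r \<pi> n ms' ls' * Z_linear r h ms ls"
  have "eq_mod_h4 r
    (\<lambda>h. \<Sum>n\<in>{- int D..int D}. \<Sum>w'\<in>words (int D) n. \<Sum>w\<in>words (int D) (- n).
      scal (TDV_weight r \<pi> g h (fst w') (snd w') * Z_weight r \<tau> f h (fst w) (snd w))
       (?W (fst w') (snd w') (fst w) (snd w)))
    (\<lambda>h. \<Sum>n\<in>{- int D..int D}. \<Sum>w'\<in>words (int D) n. \<Sum>w\<in>words (int D) (- n).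
      scal (?e h n (fst w') (snd w') (fst w) (snd w)) (?W (fst w') (snd w') (fst w) (snd w)))"
    by (rule eq_mod_h4_sum eq_mod_h4_scal)+
      (rule product_expansion[OF params], simp_all)
  moreover have "\<forall>\<^sub>F h in ILW r. transport (rescale r \<tau> f g h) (local_IM1 r \<tau> \<pi> h) v =
    (\<Sum>n\<in>{- int D..int D}. \<Sum>w'\<in>words (int D) n. \<Sum>w\<in>words (int D) (- n).
      scal (TDV_weight r \<pi> g h (fst w') (snd w') * Z_weight r \<tau> f h (fst w) (snd w))
       (?W (fst w') (snd w') (fst w) (snd w)))"
    using eventually_generic[OF params]
    by eventually_elim (simp only: local_IM1_words[OF v] case_prod_unfold)
  ultimately have "eq_mod_h4 r (\<lambda>h. transport (rescale r \<tau> f g h) (local_IM1 r \<tau> \<pi> h) v)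
    (\<lambda>h. \<Sum>n\<in>{- int D..int D}. \<Sum>w'\<in>words (int D) n. \<Sum>w\<in>words (int D) (- n).
      scal (?e h n (fst w') (snd w') (fst w) (snd w)) (?W (fst w') (snd w') (fst w) (snd w)))"
    by (rule eq_mod_h4_eventually_eq)
  moreover have "(\<Sum>n\<in>{- int D..int D}. \<Sum>w'\<in>words (int D) n. \<Sum>w\<in>words (int D) (- n).
      scal (?e h n (fst w') (snd w') (fst w) (snd w)) (?W (fst w') (snd w') (fst w) (snd w))) =
    scal 2 (v + scal (beta r * h\<^sup>2) ((\<Sum>m\<in>{1..D}. a (- int m) (a (int m) v))
         - scal (h / r) (\<Sum>m\<in>{1..D}. scal (of_nat m * coth (of_nat m * \<tau>)) (a (- int m) (a (int m) v))))
      + scal (unit_scale r h ^ 3 / 2) (\<Sum>p\<in>small_pairs D. cubic_pair v p))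
      + scal (beta r * h\<^sup>2) (Vir r \<pi> D 0 v
          + scal (unit_scale r h) (\<Sum>n\<in>{- int D..int D} - {0}. Vir r \<pi> D n (a (- n) v)))" (is "?lhs = scal 2 ?C + scal _ ?R") for h
  proof -
    have "?lhs = (\<Sum>n\<in>{- int D..int D}. (if n = 0 then scal 2 ?C else 0)
        + scal (beta r * h\<^sup>2) (Vir r \<pi> D n (if n = 0 then v else scal (unit_scale r h) (a (- n) v))))"
    proof (rule sum.cong[OF refl])
      fix n assume n: "n \<in> {- int D..int D}"
      show "(\<Sum>w'\<in>words (int D) n. \<Sum>w\<in>words (int D) (- n).
          scal (?e h n (fst w') (snd w') (fst w) (snd w)) (?W (fst w') (snd w') (fst w) (snd w))) =
        (if n = 0 then scal 2 ?C else 0)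
        + scal (beta r * h\<^sup>2) (Vir r \<pi> D n (if n = 0 then v else scal (unit_scale r h) (a (- n) v)))"
        using expansion_words[where n = n and h = h and \<pi> = \<pi>, OF v, unfolded linear_part[OF n] cubic_part]
        unfolding case_prod_unfold .
    qed
    also have "\<dots> = scal 2 ?C + scal (beta r * h\<^sup>2) (\<Sum>n\<in>{- int D..int D}.
        Vir r \<pi> D n (if n = 0 then v else scal (unit_scale r h) (a (- n) v)))"
      by (simp add: sum.distrib scal_sum_right)
    also have "(\<Sum>n\<in>{- int D..int D}. Vir r \<pi> D n (if n = 0 then v else scal (unit_scale r h) (a (- n) v))) = ?R"
      by (subst sum.remove[of _ 0])
        (auto simp: scal_sum_right fock_linear_scal[OF fock_linear_Vir] intro!: sum.cong)
    finally show ?thesis .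
  qed
  ultimately show ?thesis by (simp only:)
qed

text \<open>Modes above \<open>D\<close> vanish for two different reasons: if \<open>m > D\<close>, then \<open>a\<^sub>m\<close> kills the vector, and if
  \<open>m < - D\<close>, then \<open>L\<^sub>-\<^sub>m\<close> does, because the degree in the barred oscillators is at most \<open>D\<close>.\<close>

lemma mixed_sum:
  assumes v: "\<And>i. deg_le i (int D) v"
  shows "Sum_any (\<lambda>m::int. if m \<noteq> 0 then Lop r \<pi> (rescale r \<tau> f g) (- m) (a m v) else 0) =
    (\<Sum>n\<in>{- int D..int D} - {0}. Vir r \<pi> D n (a (- n) v))"
proof -
  have am: "deg_le Bar (int D) (a m v)" for m
    using deg_le_heis[OF v, of Bar Diag m osc_norm] by (simp add: a_def)
  have L: "Lop r \<pi> (rescale r \<tau> f g) (- m) (a m v) = Vir r \<pi> D (- m) (a m v)" if "m \<noteq> 0" for m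
    using Lop_eq[OF params am] that by simp
  have zero: "Vir r \<pi> D (- m) (a m v) = 0" if "m \<notin> {- int D..int D}" for m
  proof (cases "m > int D")
    case True
    then have "a m v = 0" by (intro a_eq_0[OF v]) auto
    then show ?thesis by (simp add: fock_linear_0[OF fock_linear_Vir])
  next
    case False
    then have "words (int D) (- m) = {}" using that by (intro words_eq_empty) auto
    then show ?thesis by (simp add: Vir_def)
  qed
  have "Sum_any (\<lambda>m::int. if m \<noteq> 0 then Lop r \<pi> (rescale r \<tau> f g) (- m) (a m v) else 0) =
    (\<Sum>m\<in>{- int D..int D} - {0}. if m \<noteq> 0 then Lop r \<pi> (rescale r \<tau> f g) (- m) (a m v) else 0)"
  proof (intro Sum_any.expand_superset subsetI)
    fix m assume "m \<in> {m. (if m \<noteq> 0 then Lop r \<pi> (rescale r \<tau> f g) (- m) (a m v) else 0) \<noteq> 0}"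
    then have "m \<noteq> 0" "Vir r \<pi> D (- m) (a m v) \<noteq> 0" by (auto simp: L split: if_splits)
    then show "m \<in> {- int D..int D} - {0}" using zero[of m] by blast
  qed simp
  also have "\<dots> = (\<Sum>n\<in>{- int D..int D} - {0}. Vir r \<pi> D n (a (- n) v))"
    by (rule sum.reindex_bij_witness[of _ uminus uminus]) (auto simp: L)
  finally show ?thesis .
qed

end

lemma diagonal_sum:
  assumes v: "deg_le Diag (int D) v"
  shows "Sum_any (\<lambda>m::nat. if m > 0 then scal (c m) (a (- int m) (a (int m) v)) else 0) =
    (\<Sum>m\<in>{1..D}. scal (c m) (a (- int m) (a (int m) v)))"
proof -
  have "a (int m) v = 0" if "m > D" for m
    using that by (intro a_eq_0[OF v]) auto
  then have "Sum_any (\<lambda>m::nat. if m > 0 then scal (c m) (a (- int m) (a (int m) v)) else 0) =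
    (\<Sum>m\<in>{1..D}. if m > 0 then scal (c m) (a (- int m) (a (int m) v)) else 0)"
    by (intro Sum_any.expand_superset)
      (auto simp: fock_linear_0[OF fock_linear_a] not_le split: if_splits, metis not_le fock_linear_0[OF fock_linear_a] scal_simps(1))
  then show ?thesis by simp
qed

theorem lemma6p1:
  fixes r \<tau> \<pi> :: complex
    and f g :: "nat \<Rightarrow> complex \<Rightarrow> complex"
    and v :: "osc fock"
  assumes "r \<noteq> 0" and "beta r \<noteq> 0"
    and "\<forall>m>0. pp \<tau> ^ m \<noteq> 1"
    and "admissible_scaling r f" and "admissible_scaling r g"
  shows "eq_mod_h4 r
    (\<lambda>h. transport (rescale r \<tau> f g h) (local_IM1 r \<tau> \<pi> h) v)
    (\<lambda>h. scal 2 v + scal (beta r * h ^ 2) (ILW_I1 r (Lop r \<pi> (rescale r \<tau> f g)) v)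
         + scal (csqrt (beta r) ^ 3 * h ^ 3) (ILW_I2 r \<tau> (Lop r \<pi> (rescale r \<tau> f g)) v))"
proof -
  obtain D where v: "\<And>i. deg_le i (int D) v" using deg_le_exists by blast
  define X where "X = (\<Sum>m\<in>{1..D}. a (- int m) (a (int m) v))"
  define Y where "Y = (\<Sum>m\<in>{1..D}. scal (of_nat m * coth (of_nat m * \<tau>)) (a (- int m) (a (int m) v)))"
  define K where "K = (\<Sum>p\<in>small_pairs D. cubic_pair v p)"
  define M where "M = (\<Sum>n\<in>{- int D..int D} - {0}. Vir r \<pi> D n (a (- n) v))"
  define s where "s = csqrt (beta r)"
  have I1: "ILW_I1 r (Lop r \<pi> (rescale r \<tau> f g)) v = Vir r \<pi> D 0 v + scal 2 X"
  proof -
    have "Sum_any (\<lambda>m::nat. if m > 0 then a (- int m) (a (int m) v) else 0) =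
        Sum_any (\<lambda>m::nat. if m > 0 then scal 1 (a (- int m) (a (int m) v)) else 0)"
      by (rule Sum_any.cong) simp
    also have "\<dots> = X" unfolding diagonal_sum[OF v] X_def by simp
    finally show ?thesis using Lop_eq[OF assms v, of \<pi> 0] by (simp add: ILW_I1_def)
  qed
  have I2: "ILW_I2 r \<tau> (Lop r \<pi> (rescale r \<tau> f g)) v = M - scal (2 * (1 - beta r) / s) Y + K"
    unfolding ILW_I2_def mixed_sum[OF assms v] diagonal_sum[OF v] cubic_sum[OF v]
    by (simp add: M_def Y_def K_def s_def)
  have beta: "beta r = s\<^sup>2" and s: "s \<noteq> 0" using assms(2) by (simp_all add: s_def)
  \<comment> \<open>The first-order term of the dressing has the factor \<open>h / r\<close>, which turns into \<open>h (1 - \<beta>)\<close>.\<close>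
  have r: "1 / r = 1 - s\<^sup>2"
    using assms(1) by (simp add: beta_def field_simps flip: beta)
  have "scal 2 (v + scal (beta r * h\<^sup>2) (X - scal (h / r) Y) + scal (unit_scale r h ^ 3 / 2) K)
      + scal (beta r * h\<^sup>2) (Vir r \<pi> D 0 v + scal (unit_scale r h) M) =
    scal 2 v + scal (beta r * h ^ 2) (ILW_I1 r (Lop r \<pi> (rescale r \<tau> f g)) v)
         + scal (csqrt (beta r) ^ 3 * h ^ 3) (ILW_I2 r \<tau> (Lop r \<pi> (rescale r \<tau> f g)) v)" for h
  proof -
    have hr: "h / r = h * (1 - s\<^sup>2)" unfolding r[symmetric] by simp
    have u: "unit_scale r h = s * h" by (simp add: unit_scale_def s_def)
    show ?thesis
      unfolding I1 I2 hr u s_def[symmetric] unfolding beta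
      by (rule poly_mapping_eqI)
        (use s in \<open>simp add: lookup_add lookup_minus field_simps power2_eq_square power3_eq_cube\<close>)
  qed
  with local_IM1_expansion[OF assms v, of \<pi>] show ?thesis
    by (simp only: X_def[symmetric] Y_def[symmetric] K_def[symmetric] M_def[symmetric])
qed

end
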